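(* Let $K$ be a perfect field, $k\subset K$ a subfield, and $\lambda\in\operatorname{Emb}(K)$ with $|\lambda^G|=n<\infty$. Let $\overline{\lambda}$ be an extension of $\lambda$ to $\overline{K}$ and $\mu=(\overline{\lambda})^{-1}|_K$. Suppose $[K(\lambda):\lambda(K)]$ is finite. Then ${}^*V(\lambda)\cong V(\lambda)^*\cong V(\mu)$, and $V(\lambda)$ has rank $n$ if and only if $V(\mu)$ has rank $n$ if and only if $[K(\lambda):\lambda(K)]=n$.
   Context: $\overline{K}$ is a fixed algebraic closure of $K$. A two-sided vector space is a $K\otimes_kK$-module; left (resp. right) multiplication by $K$ is the action of $K\otimes1$ (resp. $1\otimes K$); ${}_KV$, $V_K$ denote the restrictions of scalars; $V$ has rank $n$ if $\dim_K({}_KV)=\dim_K(V_K)=n$. $\operatorname{Emb}(K)$ is the set of $k$-linear field embeddings $K\to\overline{K}$; $G=\operatorname{Aut}(\overline{K}/K)$ acts by left composition, with orbits $\lambda^G$. For $\nu\in\operatorname{Emb}(K)$, $K(\nu)$ is the composite of $K$ and $\nu(K)$ in $\overline{K}$, and $V(\nu)$ is the two-sided vector space with underlying set $K(\nu)$ and action $a\cdot v\cdot b=av\nu(b)$. The right dual $V^*$ is $\operatorname{Hom}_K(V_K,K)$ with $(a\cdot\psi\cdot b)(x)=a\psi(bx)$; the left dual ${}^*V$ is $\operatorname{Hom}_K({}_KV,K)$ with $(a\cdot\phi\cdot b)(x)=b\phi(xa)$. *)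

theory Defs
  imports "HOL-Computational_Algebra.Polynomial" "HOL-Library.FuncSet"
begin

section \<open>Fields inside an ambient field (the type 'a plays the role of the algebraic closure)\<close>

definition is_subfield :: "'a::field set \<Rightarrow> bool" where
  "is_subfield S \<longleftrightarrow> 0 \<in> S \<and> 1 \<in> S \<and>
     (\<forall>x\<in>S. \<forall>y\<in>S. x + y \<in> S \<and> x * y \<in> S) \<and>
     (\<forall>x\<in>S. - x \<in> S) \<and> (\<forall>x\<in>S. x \<noteq> 0 \<longrightarrow> inverse x \<in> S)"

definition alg_closed_type :: "'a::field itself \<Rightarrow> bool" where
  "alg_closed_type _ \<longleftrightarrow> (\<forall>p :: 'a poly. degree p > 0 \<longrightarrow> (\<exists>x. poly p x = 0))"

definition algebraic_over :: "'a::field set \<Rightarrow> 'a \<Rightarrow> bool" where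
  "algebraic_over K x \<longleftrightarrow> (\<exists>p. p \<noteq> 0 \<and> (\<forall>i. coeff p i \<in> K) \<and> poly p x = 0)"

definition is_alg_closure_of :: "'a::field set \<Rightarrow> bool" where
  "is_alg_closure_of K \<longleftrightarrow> alg_closed_type TYPE('a) \<and> (\<forall>x. algebraic_over K x)"

definition perfect_subfield :: "'a::field set \<Rightarrow> bool" where
  "perfect_subfield K \<longleftrightarrow> is_subfield K \<and>
     (CHAR('a) = 0 \<or> (\<forall>x\<in>K. \<exists>y\<in>K. y ^ CHAR('a) = x))"

definition Emb :: "'a::field set \<Rightarrow> 'a set \<Rightarrow> ('a \<Rightarrow> 'a) set" where
  "Emb k K = {\<sigma>. \<sigma> \<in> extensional K \<and>
     (\<forall>x\<in>K. \<forall>y\<in>K. \<sigma> (x + y) = \<sigma> x + \<sigma> y \<and> \<sigma> (x * y) = \<sigma> x * \<sigma> y) \<and>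
     \<sigma> 1 = 1 \<and> (\<forall>c\<in>k. \<forall>x\<in>K. \<sigma> (c * x) = c * \<sigma> x)}"

definition full_emb :: "'a::field set \<Rightarrow> ('a \<Rightarrow> 'a) \<Rightarrow> bool" where
  "full_emb k \<sigma> \<longleftrightarrow> (\<forall>x y. \<sigma> (x + y) = \<sigma> x + \<sigma> y \<and> \<sigma> (x * y) = \<sigma> x * \<sigma> y) \<and>
     \<sigma> 1 = 1 \<and> (\<forall>c\<in>k. \<forall>x. \<sigma> (c * x) = c * \<sigma> x)"

definition Aut_over :: "'a::field set \<Rightarrow> ('a \<Rightarrow> 'a) set" where
  "Aut_over K = {g. bij g \<and> (\<forall>x y. g (x + y) = g x + g y \<and> g (x * y) = g x * g y) \<and>
     (\<forall>x\<in>K. g x = x)}"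

definition orbit :: "'a::field set \<Rightarrow> ('a \<Rightarrow> 'a) \<Rightarrow> ('a \<Rightarrow> 'a) set" where
  "orbit K lam = {restrict (g \<circ> lam) K | g. g \<in> Aut_over K}"

definition composite :: "'a::field set \<Rightarrow> 'a set \<Rightarrow> 'a set" where
  "composite A B = \<Inter>{F. is_subfield F \<and> A \<union> B \<subseteq> F}"

record ('a, 'v) tsv =
  tcar :: "'v set"
  tadd :: "'v \<Rightarrow> 'v \<Rightarrow> 'v"
  tzero :: 'v
  tlmul :: "'a \<Rightarrow> 'v \<Rightarrow> 'v"
  trmul :: "'v \<Rightarrow> 'a \<Rightarrow> 'v"

definition Vsp :: "'a::field set \<Rightarrow> ('a \<Rightarrow> 'a) \<Rightarrow> ('a, 'a) tsv" where
  "Vsp K \<nu> = \<lparr> tcar = composite K (\<nu> ` K), tadd = (+), tzero = 0,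
     tlmul = (\<lambda>a v. a * v), trmul = (\<lambda>v b. v * \<nu> b) \<rparr>"

definition rdual :: "'a::field set \<Rightarrow> ('a, 'v) tsv \<Rightarrow> ('a, 'v \<Rightarrow> 'a) tsv" where
  "rdual K V = \<lparr>
     tcar = {\<psi>. \<psi> \<in> extensional (tcar V) \<and> \<psi> \<in> tcar V \<rightarrow> K \<and>
              (\<forall>x\<in>tcar V. \<forall>y\<in>tcar V. \<psi> (tadd V x y) = \<psi> x + \<psi> y) \<and>
              (\<forall>x\<in>tcar V. \<forall>b\<in>K. \<psi> (trmul V x b) = \<psi> x * b)},
     tadd = (\<lambda>\<psi> \<phi>. restrict (\<lambda>x. \<psi> x + \<phi> x) (tcar V)),
     tzero = restrict (\<lambda>x. 0) (tcar V),
     tlmul = (\<lambda>a \<psi>. restrict (\<lambda>x. a * \<psi> x) (tcar V)),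
     trmul = (\<lambda>\<psi> b. restrict (\<lambda>x. \<psi> (tlmul V b x)) (tcar V)) \<rparr>"

definition ldual :: "'a::field set \<Rightarrow> ('a, 'v) tsv \<Rightarrow> ('a, 'v \<Rightarrow> 'a) tsv" where
  "ldual K V = \<lparr>
     tcar = {\<phi>. \<phi> \<in> extensional (tcar V) \<and> \<phi> \<in> tcar V \<rightarrow> K \<and>
              (\<forall>x\<in>tcar V. \<forall>y\<in>tcar V. \<phi> (tadd V x y) = \<phi> x + \<phi> y) \<and>
              (\<forall>x\<in>tcar V. \<forall>a\<in>K. \<phi> (tlmul V a x) = a * \<phi> x)},
     tadd = (\<lambda>\<psi> \<phi>. restrict (\<lambda>x. \<psi> x + \<phi> x) (tcar V)),
     tzero = restrict (\<lambda>x. 0) (tcar V),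
     tlmul = (\<lambda>a \<phi>. restrict (\<lambda>x. \<phi> (trmul V x a)) (tcar V)),
     trmul = (\<lambda>\<phi> b. restrict (\<lambda>x. b * \<phi> x) (tcar V)) \<rparr>"

text \<open>Isomorphism of two-sided vector spaces (= K \<otimes>_k K-module isomorphism).\<close>
definition tsv_iso :: "'a set \<Rightarrow> ('a, 'v) tsv \<Rightarrow> ('a, 'w) tsv \<Rightarrow> bool" where
  "tsv_iso K V W \<longleftrightarrow> (\<exists>f. bij_betw f (tcar V) (tcar W) \<and>
     (\<forall>x\<in>tcar V. \<forall>y\<in>tcar V. f (tadd V x y) = tadd W (f x) (f y)) \<and>
     (\<forall>a\<in>K. \<forall>x\<in>tcar V. f (tlmul V a x) = tlmul W a (f x)) \<and>
     (\<forall>b\<in>K. \<forall>x\<in>tcar V. f (trmul V x b) = trmul W (f x) b))"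

definition lincomb :: "('a \<Rightarrow> 'v \<Rightarrow> 'v) \<Rightarrow> ('v \<Rightarrow> 'v \<Rightarrow> 'v) \<Rightarrow> 'v \<Rightarrow> 'a list \<Rightarrow> 'v list \<Rightarrow> 'v" where
  "lincomb sm ad z cs bs = foldr (\<lambda>(c, b) acc. ad (sm c b) acc) (zip cs bs) z"

definition is_basis :: "'a set \<Rightarrow> ('a \<Rightarrow> 'v \<Rightarrow> 'v) \<Rightarrow> ('v \<Rightarrow> 'v \<Rightarrow> 'v) \<Rightarrow> 'v \<Rightarrow> 'v set \<Rightarrow> 'v list \<Rightarrow> bool" where
  "is_basis F sm ad z V bs \<longleftrightarrow> set bs \<subseteq> V \<and>
     (\<forall>v\<in>V. \<exists>!cs. length cs = length bs \<and> set cs \<subseteq> F \<and> lincomb sm ad z cs bs = v)"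

definition has_dim :: "'a set \<Rightarrow> ('a \<Rightarrow> 'v \<Rightarrow> 'v) \<Rightarrow> ('v \<Rightarrow> 'v \<Rightarrow> 'v) \<Rightarrow> 'v \<Rightarrow> 'v set \<Rightarrow> nat \<Rightarrow> bool" where
  "has_dim F sm ad z V n \<longleftrightarrow> (\<exists>bs. length bs = n \<and> is_basis F sm ad z V bs)"

definition has_rank :: "'a set \<Rightarrow> ('a, 'v) tsv \<Rightarrow> nat \<Rightarrow> bool" where
  "has_rank K V n \<longleftrightarrow> has_dim K (tlmul V) (tadd V) (tzero V) (tcar V) n \<and>
     has_dim K (\<lambda>b v. trmul V v b) (tadd V) (tzero V) (tcar V) n"

definition field_degree_is :: "'a::field set \<Rightarrow> 'a set \<Rightarrow> nat \<Rightarrow> bool" where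
  "field_degree_is L F n \<longleftrightarrow> has_dim F (\<lambda>a v. a * v) (+) 0 L n"

end

theory Submission
  imports Defs "HOL-Computational_Algebra.Primes"
begin

text \<open>
  Let \<open>F\<close> be the composite of \<open>K\<close> and \<open>\<lambda>(K)\<close>. The restrictions of \<open>Aut(\<^bold>K/K)\<close> to \<open>F\<close>, with \<open>\<^bold>K\<close>
  the algebraic closure, are determined by their composites with \<open>\<lambda>\<close>, so there are exactly \<open>n\<close> of
  them. Since \<open>K\<close> is perfect, the fixed field of \<open>Aut(\<^bold>K/K)\<close> is \<open>K\<close>, and Artin's argument gives
  \<open>[F : K] = n\<close>. Hence either rank condition reduces to \<open>[F : \<lambda>(K)] = n\<close>.

  For each of the two duals, fix a nonzero functional \<open>\<psi>\<close>; by counting dimensions,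
  \<open>f \<mapsto> \<psi>(f \<cdot>)\<close> is a bijection from \<open>F\<close> onto the dual. Both duals are thereby
  identified with \<open>F\<close> carrying the action \<open>a \<cdot> v \<cdot> b = \<lambda>(a) v b\<close>, which the inverse of the extension
  of \<open>\<lambda>\<close> maps onto \<open>V(\<mu>)\<close>. That extension is surjective because \<open>F\<close>, being finite over \<open>\<lambda>(K)\<close>,
  lies in its algebraically closed image.
\<close>

section \<open>Linear algebra over a subfield\<close>

lemma is_subfieldD:
  assumes "is_subfield S"
  shows "0 \<in> S" "1 \<in> S" "\<And>x y. x \<in> S \<Longrightarrow> y \<in> S \<Longrightarrow> x + y \<in> S"
    "\<And>x y. x \<in> S \<Longrightarrow> y \<in> S \<Longrightarrow> x * y \<in> S" "\<And>x. x \<in> S \<Longrightarrow> - x \<in> S"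
    "\<And>x. x \<in> S \<Longrightarrow> inverse x \<in> S" "\<And>x y. x \<in> S \<Longrightarrow> y \<in> S \<Longrightarrow> x - y \<in> S"
    "\<And>x y. x \<in> S \<Longrightarrow> y \<in> S \<Longrightarrow> x / y \<in> S"
proof -
  show *: "0 \<in> S" "1 \<in> S" "\<And>x y. x \<in> S \<Longrightarrow> y \<in> S \<Longrightarrow> x + y \<in> S"
    "\<And>x y. x \<in> S \<Longrightarrow> y \<in> S \<Longrightarrow> x * y \<in> S" "\<And>x. x \<in> S \<Longrightarrow> - x \<in> S"
    using assms unfolding is_subfield_def by auto
  show inv: "inverse x \<in> S" if "x \<in> S" for x
    using assms that unfolding is_subfield_def by (cases "x = 0") auto
  show "x - y \<in> S" if "x \<in> S" "y \<in> S" for x y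
    using *(3)[OF that(1) *(5)[OF that(2)]] by simp
  show "x / y \<in> S" if "x \<in> S" "y \<in> S" for x y
    using *(4)[OF that(1) inv[OF that(2)]] by (simp add: field_simps)
qed

lemma is_subfield_sum:
  assumes "is_subfield S" "\<And>i. i \<in> A \<Longrightarrow> f i \<in> S"
  shows "sum f A \<in> S"
  using assms(2) by (induction A rule: infinite_finite_induct) (auto intro: is_subfieldD[OF assms(1)])

lemma is_subfield_power:
  "is_subfield S \<Longrightarrow> x \<in> S \<Longrightarrow> x ^ n \<in> S"
  by (induction n) (auto intro: is_subfieldD)

lemma is_subfield_UNIV: "is_subfield UNIV"
  by (simp add: is_subfield_def)

lemma is_subfield_composite: "is_subfield (composite A B)"
  unfolding is_subfield_def composite_def by auto

lemma composite_minimal: "is_subfield F \<Longrightarrow> A \<subseteq> F \<Longrightarrow> B \<subseteq> F \<Longrightarrow> composite A B \<subseteq> F"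
  unfolding composite_def by auto

lemma composite_upper: "A \<subseteq> composite A B" "B \<subseteq> composite A B"
  unfolding composite_def by auto

text \<open>Gaussian elimination, by induction on the equations: a nonzero entry
  \<open>a i0 p\<close> serves as pivot, which removes one equation and one unknown and so keeps the
  unknowns in excess. Every later dimension bound is an instance of this.\<close>

lemma underdetermined_system:
  assumes L: "is_subfield L" and "finite I" "finite J" "card I < card J"
    and "\<And>i j. i \<in> I \<Longrightarrow> j \<in> J \<Longrightarrow> a i j \<in> L"
  shows "\<exists>c. (\<forall>j\<in>J. c j \<in> L) \<and> (\<exists>j\<in>J. c j \<noteq> 0) \<and> (\<forall>i\<in>I. (\<Sum>j\<in>J. a i j * c j) = 0)"
  using assms(2-5)
proof (induction I arbitrary: J a rule: finite_induct)
  case empty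
  then have "J \<noteq> {}" by auto
  then show ?case
    by (intro exI[of _ "\<lambda>_. 1"]) (auto intro: is_subfieldD[OF L])
next
  case (insert i0 I)
  show ?case
  proof (cases "\<forall>j\<in>J. a i0 j = 0")
    case True
    have "\<exists>c. (\<forall>j\<in>J. c j \<in> L) \<and> (\<exists>j\<in>J. c j \<noteq> 0) \<and> (\<forall>i\<in>I. (\<Sum>j\<in>J. a i j * c j) = 0)"
      using insert.prems insert.hyps by (intro insert.IH) auto
    then show ?thesis using True by auto
  next
    case False
    then obtain p where p: "p \<in> J" "a i0 p \<noteq> 0" by blast
    define J' where "J' = J - {p}"
    \<comment> \<open>Row reduction: subtracting \<open>a i p / a i0 p\<close> times equation
      \<open>i0\<close> from equation \<open>i\<close> clears the unknown \<open>p\<close>.\<close>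
    define a' where "a' i j = a i j - a i p * a i0 j / a i0 p" for i j
    have J': "finite J'" "card I < card J'"
      using insert.prems insert.hyps p by (auto simp: J'_def)
    have "\<exists>c. (\<forall>j\<in>J'. c j \<in> L) \<and> (\<exists>j\<in>J'. c j \<noteq> 0) \<and> (\<forall>i\<in>I. (\<Sum>j\<in>J'. a' i j * c j) = 0)"
      using p J' insert.prems by (intro insert.IH) (auto simp: a'_def J'_def intro!: is_subfieldD[OF L])
    then obtain c where c: "\<forall>j\<in>J'. c j \<in> L" "\<exists>j\<in>J'. c j \<noteq> 0"
      "\<And>i. i \<in> I \<Longrightarrow> (\<Sum>j\<in>J'. a' i j * c j) = 0" by blast
    define s where "s = (\<Sum>j\<in>J'. a i0 j * c j)"
    \<comment> \<open>Back substitution: equation \<open>i0\<close> forces the value at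
      \<open>p\<close>, with \<open>s\<close> the contribution of the other unknowns.\<close>
    define d where "d = c(p := - s / a i0 p)"
    have dL: "\<forall>j\<in>J. d j \<in> L"
      using c(1) p insert.prems
      by (auto simp: d_def s_def J'_def intro!: is_subfieldD[OF L] is_subfield_sum[OF L])
    have split: "(\<Sum>j\<in>J. a i j * d j) = (\<Sum>j\<in>J'. a i j * c j) - a i p * s / a i0 p" for i
    proof -
      have "(\<Sum>j\<in>J. a i j * d j) = a i p * d p + (\<Sum>j\<in>J'. a i j * d j)"
        using p insert.prems by (simp add: sum.remove J'_def)
      also have "(\<Sum>j\<in>J'. a i j * d j) = (\<Sum>j\<in>J'. a i j * c j)"
        by (intro sum.cong) (auto simp: d_def J'_def)
      finally show ?thesis by (simp add: d_def)
    qed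
    have "(\<Sum>j\<in>J. a i j * d j) = 0" if "i \<in> I" for i
    proof -
      have "(\<Sum>j\<in>J'. a' i j * c j) = (\<Sum>j\<in>J'. a i j * c j) - (a i p / a i0 p) * s"
        by (simp add: a'_def s_def sum_subtractf sum_distrib_left algebra_simps)
      then show ?thesis using c(3)[OF that] split[of i] by simp
    qed
    moreover have "(\<Sum>j\<in>J. a i0 j * d j) = 0"
      using split[of i0] p by (simp add: s_def)
    moreover have "\<exists>j\<in>J. d j \<noteq> 0"
      using c(2) by (auto simp: d_def J'_def)
    ultimately show ?thesis using dL by (intro exI[of _ d]) auto
  qed
qed

section \<open>Bases as indexed families, and transport of dimension\<close>

lemma lincomb_eq_sum:
  "length cs = length bs \<Longrightarrow>
    lincomb sm (+) 0 cs bs = (\<Sum>i<length bs. sm (cs ! i) (bs ! i))"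
proof (induction cs bs rule: list_induct2)
  case Nil
  then show ?case by (simp add: lincomb_def)
next
  case (Cons x xs y ys)
  then show ?case
    by (simp add: lincomb_def sum.lessThan_Suc_shift del: sum.lessThan_Suc)
qed

text \<open>Uniqueness of the coordinates of \<open>0\<close>, compared with the zero list, gives
  independence; conversely the difference of two coordinate lists is a linear relation. This trades
  lists for indexed sums, on which the later arguments compute.\<close>

lemma has_dim_iff_sum:
  assumes F: "is_subfield F" and V0: "0 \<in> V"
  shows "has_dim F (\<lambda>a v. a * v) (+) 0 V n \<longleftrightarrow>
    (\<exists>b. (\<forall>i<n. b i \<in> V) \<and>
         (\<forall>v\<in>V. \<exists>c. (\<forall>i<n. c i \<in> F) \<and> v = (\<Sum>i<n. c i * b i)) \<and>
         (\<forall>c. (\<forall>i<n. c i \<in> F) \<and> (\<Sum>i<n. c i * b i) = 0 \<longrightarrow> (\<forall>i<n. c i = 0)))"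
    (is "_ \<longleftrightarrow> (\<exists>b. ?basis b)")
proof
  assume "has_dim F (\<lambda>a v. a * v) (+) 0 V n"
  then obtain bs where len: "length bs = n" and basis: "is_basis F (\<lambda>a v. a * v) (+) 0 V bs"
    unfolding has_dim_def by (elim exE conjE)
  note sub = basis[unfolded is_basis_def, THEN conjunct1]
  note uniq = basis[unfolded is_basis_def, THEN conjunct2, rule_format]
  have "?basis (\<lambda>i. bs ! i)"
  proof (intro conjI allI impI ballI)
    show "bs ! i \<in> V" if "i < n" for i using that len sub by auto
  next
    fix v assume "v \<in> V"
    then obtain cs where cs: "length cs = length bs" "set cs \<subseteq> F" "lincomb (\<lambda>a v. a * v) (+) 0 cs bs = v"
      using uniq by blast
    then show "\<exists>c. (\<forall>i<n. c i \<in> F) \<and> v = (\<Sum>i<n. c i * bs ! i)"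
      using len by (intro exI[of _ "\<lambda>i. cs ! i"]) (auto simp: lincomb_eq_sum)
  next
    fix c i assume c: "(\<forall>i<n. c i \<in> F) \<and> (\<Sum>i<n. c i * bs ! i) = 0" and i: "i < n"
    have "length (map c [0..<n]) = length bs \<and> set (map c [0..<n]) \<subseteq> F \<and>
          lincomb (\<lambda>a v. a * v) (+) 0 (map c [0..<n]) bs = 0"
      using c len by (auto simp: lincomb_eq_sum)
    moreover have "length (replicate n 0) = length bs \<and> set (replicate n 0) \<subseteq> F \<and>
          lincomb (\<lambda>a v. a * v) (+) 0 (replicate n 0) bs = 0"
      using len is_subfieldD(1)[OF F] by (auto simp: lincomb_eq_sum)
    ultimately have "map c [0..<n] = replicate n 0"
      using uniq[OF V0] by blast
    then have "map c [0..<n] ! i = replicate n 0 ! i" by simp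
    then show "c i = 0" using i by simp
  qed
  then show "\<exists>b. ?basis b" by blast
next
  assume "\<exists>b. ?basis b"
  then obtain b where b: "?basis b" ..
  note indep = conjunct2[OF conjunct2[OF b]]
  let ?bs = "map b [0..<n]"
  have lc: "lincomb (\<lambda>a v. a * v) (+) 0 cs ?bs = (\<Sum>i<n. cs ! i * b i)" if "length cs = n" for cs
    using that by (simp add: lincomb_eq_sum)
  have "is_basis F (\<lambda>a v. a * v) (+) 0 V ?bs"
    unfolding is_basis_def
  proof (intro conjI ballI)
    show "set ?bs \<subseteq> V" using b by auto
  next
    fix v assume "v \<in> V"
    then obtain c where c: "\<forall>i<n. c i \<in> F" "v = (\<Sum>i<n. c i * b i)"
      using b by blast
    show "\<exists>!cs. length cs = length ?bs \<and> set cs \<subseteq> F \<and> lincomb (\<lambda>a v. a * v) (+) 0 cs ?bs = v"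
    proof (rule ex1I[of _ "map c [0..<n]"])
      show "length (map c [0..<n]) = length ?bs \<and> set (map c [0..<n]) \<subseteq> F \<and>
        lincomb (\<lambda>a v. a * v) (+) 0 (map c [0..<n]) ?bs = v"
        using c by (auto simp: lc)
    next
      fix cs assume cs: "length cs = length ?bs \<and> set cs \<subseteq> F \<and> lincomb (\<lambda>a v. a * v) (+) 0 cs ?bs = v"
      then have "(\<Sum>i<n. (cs ! i - c i) * b i) = 0"
        using c lc[of cs] by (simp add: left_diff_distrib sum_subtractf)
      moreover have "\<forall>i<n. cs ! i - c i \<in> F"
        using cs c(1) by (auto intro!: is_subfieldD[OF F])
      ultimately have "\<forall>i<n. cs ! i - c i = 0"
        by (intro indep[THEN spec[where x = "\<lambda>i. cs ! i - c i"], THEN mp] conjI)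
      then show "cs = map c [0..<n]"
        using cs by (intro nth_equalityI) auto
    qed
  qed
  then show "has_dim F (\<lambda>a v. a * v) (+) 0 V n"
    unfolding has_dim_def by (intro exI[of _ ?bs]) auto
qed

lemma lincomb_map:
  assumes "h 0 = (0::'b::comm_monoid_add)" "\<And>x y. h (x + y) = h x + h (y::'a::comm_monoid_add)"
    and "\<And>a v. a \<in> S \<Longrightarrow> h (sm a v) = sm' (\<phi> a) (h v)"
    and "length cs = length bs" "set cs \<subseteq> S"
  shows "lincomb sm' (+) 0 (map \<phi> cs) (map h bs) = h (lincomb sm (+) 0 cs bs)"
  using assms(4,5)
  by (induction cs bs rule: list_induct2) (auto simp: lincomb_def assms(1-3))

text \<open>A semilinear injection carries bases to bases, the coordinates changing by
  \<open>\<phi>\<close>. With \<open>h\<close> the identity it renames scalars; with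
  \<open>h\<close> an extension of \<open>lam\<close> it compares V(mu) with V(lam).\<close>

lemma has_dim_semilinear:
  fixes h :: "'v::comm_monoid_add \<Rightarrow> 'w::comm_monoid_add"
  assumes h0: "h 0 = 0" and add: "\<And>x y. h (x + y) = h x + h y" and inj: "inj h"
    and \<phi>: "bij_betw \<phi> S S'"
    and sm: "\<And>a v. a \<in> S \<Longrightarrow> h (sm a v) = sm' (\<phi> a) (h v)"
  shows "has_dim S' sm' (+) 0 (h ` V) n \<longleftrightarrow> has_dim S sm (+) 0 V n"
proof -
  have *: "is_basis S' sm' (+) 0 (h ` V) (map h bs) \<longleftrightarrow> is_basis S sm (+) 0 V bs" for bs
  proof -
    define P where "P v cs \<longleftrightarrow> length cs = length bs \<and> set cs \<subseteq> S \<and> lincomb sm (+) 0 cs bs = v" for v cs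
    define P' where "P' v cs \<longleftrightarrow> length cs = length (map h bs) \<and> set cs \<subseteq> S' \<and>
      lincomb sm' (+) 0 cs (map h bs) = v" for v cs
    \<comment> \<open>Every coefficient list over \<open>S'\<close> comes from one over
      \<open>S\<close>, so uniqueness of coordinates can be tested on images.\<close>
    have lift: "\<exists>cs. set cs \<subseteq> S \<and> cs' = map \<phi> cs" if "set cs' \<subseteq> S'" for cs'
    proof -
      have "cs' \<in> lists (\<phi> ` S)" using that \<phi> by (auto simp: bij_betw_def)
      then show ?thesis by (auto simp: lists_image)
    qed
    have P': "P' (h v) (map \<phi> cs) \<longleftrightarrow> P v cs" if "set cs \<subseteq> S" for v cs
    proof (cases "length cs = length bs")
      case True
      have "lincomb sm' (+) 0 (map \<phi> cs) (map h bs) = h (lincomb sm (+) 0 cs bs)"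
        using lincomb_map[of h S sm sm' \<phi>] h0 add sm True that by blast
      then show ?thesis
        using that True \<phi> inj by (auto simp: P_def P'_def bij_betw_def inj_eq)
    qed (auto simp: P_def P'_def)
    have inj_map: "cs = ds" if "set cs \<subseteq> S" "set ds \<subseteq> S" "map \<phi> cs = map \<phi> ds" for cs ds
      using that \<phi> by (metis bij_betw_def inj_on_subset map_inj_on sup.bounded_iff)
    have "(\<exists>!cs. P' (h v) cs) \<longleftrightarrow> (\<exists>!cs. P v cs)" for v
    proof
      assume "\<exists>!cs. P' (h v) cs"
      then obtain cs' where cs': "P' (h v) cs'" "\<And>ds. P' (h v) ds \<Longrightarrow> ds = cs'" by blast
      then obtain cs where cs: "set cs \<subseteq> S" "cs' = map \<phi> cs" using lift by (metis P'_def)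
      show "\<exists>!cs. P v cs"
      proof (rule ex1I[of _ cs])
        show "P v cs" using P' cs cs' by blast
        show "ds = cs" if "P v ds" for ds
          using cs'(2)[of "map \<phi> ds"] P'[of ds v] that cs inj_map[of ds cs] by (auto simp: P_def)
      qed
    next
      assume "\<exists>!cs. P v cs"
      then obtain cs where cs: "P v cs" "\<And>ds. P v ds \<Longrightarrow> ds = cs" by blast
      show "\<exists>!cs. P' (h v) cs"
      proof (rule ex1I[of _ "map \<phi> cs"])
        have "set cs \<subseteq> S" using cs(1) by (simp add: P_def)
        then show "P' (h v) (map \<phi> cs)" using P' cs(1) by blast
        fix ds' assume ds': "P' (h v) ds'"
        then obtain ds where "set ds \<subseteq> S" "ds' = map \<phi> ds" using lift by (metis P'_def)
        then show "ds' = map \<phi> cs" using ds' P' cs(2) by blast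
      qed
    qed
    moreover have "set (map h bs) \<subseteq> h ` V \<longleftrightarrow> set bs \<subseteq> V"
      using inj by (auto simp: inj_image_subset_iff)
    ultimately show ?thesis
      unfolding is_basis_def P_def P'_def by simp
  qed
  show ?thesis
  proof
    assume "has_dim S' sm' (+) 0 (h ` V) n"
    then obtain bs' where bs': "length bs' = n" "is_basis S' sm' (+) 0 (h ` V) bs'"
      unfolding has_dim_def by blast
    then have "bs' \<in> lists (h ` V)" unfolding is_basis_def by auto
    then obtain bs where "bs' = map h bs" by (auto simp: lists_image)
    then show "has_dim S sm (+) 0 V n" using bs' * unfolding has_dim_def by auto
  next
    assume "has_dim S sm (+) 0 V n"
    then show "has_dim S' sm' (+) 0 (h ` V) n"
      using * unfolding has_dim_def by (metis length_map)
  qed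
qed

section \<open>Extension of partial homomorphisms to automorphisms\<close>

text \<open>Graphs of homomorphisms over \<open>K\<close> from a subring into the ambient field. No closure under inverses
  is demanded: it is automatic when every element is algebraic over \<open>K\<close>.\<close>
definition partial_hom :: "'a::field set \<Rightarrow> ('a \<times> 'a) set \<Rightarrow> bool" where
  "partial_hom K R \<longleftrightarrow> (\<forall>c\<in>K. (c, c) \<in> R) \<and>
     (\<forall>a b c d. (a, b) \<in> R \<longrightarrow> (c, d) \<in> R \<longrightarrow> (a + c, b + d) \<in> R \<and> (a * c, b * d) \<in> R) \<and>
     (\<forall>y. (0, y) \<in> R \<longrightarrow> y = 0)"

text \<open>Here \<open>q\<close> is \<open>p\<close> with the homomorphism applied to its
  coefficients, stated as a relation because the graph \<open>R\<close> is defined only on a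
  subring.\<close>

definition rel_poly :: "('a \<times> 'a) set \<Rightarrow> 'a::field poly \<Rightarrow> 'a poly \<Rightarrow> bool" where
  "rel_poly R p q \<longleftrightarrow> (\<forall>i. (coeff p i, coeff q i) \<in> R)"

text \<open>Multiplying by \<open>(- 1, - 1)\<close> gives negatives, hence differences.
  Single-valuedness then follows from the trivial-kernel condition: two values of \<open>a\<close>
  differ by a value of \<open>0\<close>.\<close>

lemma partial_homD:
  assumes "is_subfield K" "partial_hom K R"
  shows "\<And>c. c \<in> K \<Longrightarrow> (c, c) \<in> R" "(0, 0) \<in> R"
    "\<And>a b c d. (a, b) \<in> R \<Longrightarrow> (c, d) \<in> R \<Longrightarrow> (a + c, b + d) \<in> R"
    "\<And>a b c d. (a, b) \<in> R \<Longrightarrow> (c, d) \<in> R \<Longrightarrow> (a * c, b * d) \<in> R"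
    "\<And>a b. (a, b) \<in> R \<Longrightarrow> (- a, - b) \<in> R"
    "\<And>a b c d. (a, b) \<in> R \<Longrightarrow> (c, d) \<in> R \<Longrightarrow> (a - c, b - d) \<in> R"
    "\<And>y. (0, y) \<in> R \<Longrightarrow> y = 0" "\<And>a b c. (a, b) \<in> R \<Longrightarrow> (a, c) \<in> R \<Longrightarrow> b = c"
proof -
  show *: "\<And>c. c \<in> K \<Longrightarrow> (c, c) \<in> R"
    "\<And>a b c d. (a, b) \<in> R \<Longrightarrow> (c, d) \<in> R \<Longrightarrow> (a + c, b + d) \<in> R"
    "\<And>a b c d. (a, b) \<in> R \<Longrightarrow> (c, d) \<in> R \<Longrightarrow> (a * c, b * d) \<in> R"
    "\<And>y. (0, y) \<in> R \<Longrightarrow> y = 0"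
    using assms(2) unfolding partial_hom_def by blast+
  show "(0, 0) \<in> R" using * is_subfieldD(1)[OF assms(1)] by blast
  have "- 1 \<in> K" using is_subfieldD[OF assms(1)] by blast
  from *(3)[OF *(1)[OF this]] show neg: "(- a, - b) \<in> R" if "(a, b) \<in> R" for a b
    using that by fastforce
  from *(2)[OF _ neg] show minus: "(a - c, b - d) \<in> R" if "(a, b) \<in> R" "(c, d) \<in> R" for a b c d
    using that by fastforce
  show "b = c" if "(a, b) \<in> R" "(a, c) \<in> R" for a b c
    using minus[OF that] *(4)[of "b - c"] by simp
qed

lemma rel_poly_ops:
  assumes K: "is_subfield K" and R: "partial_hom K R"
  shows "rel_poly R p q \<Longrightarrow> rel_poly R p' q' \<Longrightarrow> rel_poly R (p + p') (q + q')"
    "rel_poly R p q \<Longrightarrow> rel_poly R p' q' \<Longrightarrow> rel_poly R (p - p') (q - q')"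
    "rel_poly R p q \<Longrightarrow> rel_poly R p' q' \<Longrightarrow> rel_poly R (p * p') (q * q')"
    "(a, b) \<in> R \<Longrightarrow> rel_poly R (monom a n) (monom b n)"
    "(a, b) \<in> R \<Longrightarrow> rel_poly R p q \<Longrightarrow> rel_poly R (pCons a p) (pCons b q)"
    "rel_poly R (pCons a p) (pCons b q) \<Longrightarrow> (a, b) \<in> R \<and> rel_poly R p q"
    "rel_poly R 0 0"
proof -
  note R' = partial_homD[OF K R]
  show "rel_poly R p q \<Longrightarrow> rel_poly R p' q' \<Longrightarrow> rel_poly R (p + p') (q + q')"
    "rel_poly R p q \<Longrightarrow> rel_poly R p' q' \<Longrightarrow> rel_poly R (p - p') (q - q')"
    "(a, b) \<in> R \<Longrightarrow> rel_poly R (monom a n) (monom b n)" "rel_poly R 0 0"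
    by (auto simp: rel_poly_def R' coeff_monom)
  have sum: "(sum f A, sum g A) \<in> R" if "\<And>i. (f i, g i) \<in> R" for f g and A :: "nat set"
    by (induction A rule: infinite_finite_induct) (auto intro: R' that)
  show "rel_poly R p q \<Longrightarrow> rel_poly R p' q' \<Longrightarrow> rel_poly R (p * p') (q * q')"
    unfolding rel_poly_def coeff_mult by (auto intro!: sum R')
  show "(a, b) \<in> R \<Longrightarrow> rel_poly R p q \<Longrightarrow> rel_poly R (pCons a p) (pCons b q)"
    by (auto simp: rel_poly_def coeff_pCons split: nat.split)
  show "(a, b) \<in> R \<and> rel_poly R p q" if "rel_poly R (pCons a p) (pCons b q)"
    using that unfolding rel_poly_def by (metis coeff_pCons_0 coeff_pCons_Suc)
qed

text \<open>Horner's scheme: evaluation uses only sums and products, which \<open>R\<close>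
  respects.\<close>

lemma rel_poly_poly:
  assumes K: "is_subfield K" and R: "partial_hom K R" and xy: "(x, y) \<in> R"
  shows "rel_poly R p q \<Longrightarrow> (poly p x, poly q y) \<in> R"
proof (induction p arbitrary: q)
  case 0
  have "q = 0"
    using 0 partial_homD(7)[OF K R] by (intro poly_eqI) (auto simp: rel_poly_def)
  then show ?case using partial_homD(2)[OF K R] by simp
next
  case (pCons a p)
  obtain b q' where q: "q = pCons b q'" by (cases q)
  then show ?case
    using pCons.IH[of q'] pCons.prems rel_poly_ops(6)[OF K R, of a p b q'] xy
    by (auto intro: partial_homD[OF K R])
qed

text \<open>The inverse of an algebraic element is a polynomial in it: if \<open>c + X q\<close> is
  its polynomial of least degree over \<open>K\<close>, then the inverse is
  \<open>- q(a) / c\<close>. Polynomials over \<open>K\<close> are related to themselves, so the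
  same formula gives the inverse of \<open>b\<close>.\<close>

lemma partial_hom_inverse:
  assumes K: "is_subfield K" and R: "partial_hom K R" and alg: "algebraic_over K a"
    and ab: "(a, b) \<in> R" and a: "a \<noteq> 0"
  shows "b \<noteq> 0" "(inverse a, inverse b) \<in> R"
proof -
  note R' = partial_homD[OF K R]
  define P where "P p \<longleftrightarrow> p \<noteq> 0 \<and> (\<forall>i. coeff p i \<in> K) \<and> poly p a = 0" for p
  have "\<exists>p. P p" using alg unfolding algebraic_over_def P_def .
  then obtain p where p: "P p" and min: "\<And>q. P q \<Longrightarrow> degree p \<le> degree q"
    using ex_has_least_nat[of P _ degree] by blast
  obtain c q where pq: "p = pCons c q" by (cases p)
  have qK: "\<forall>i. coeff q i \<in> K" using p by (auto simp: P_def pq coeff_pCons split: nat.splits)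
  have cK: "c \<in> K" using p by (auto simp: P_def pq coeff_pCons split: nat.splits)
  have val: "c + a * poly q a = 0" using p by (simp add: P_def pq)
  \<comment> \<open>Otherwise \<open>a \<noteq> 0\<close> could be cancelled, leaving
    \<open>q\<close> as an annihilating polynomial of smaller degree.\<close>
  have "c \<noteq> 0"
  proof
    assume "c = 0"
    then have "P q" using p val a qK by (auto simp: P_def pq)
    then have "degree p \<le> degree q" by (rule min)
    then show False using p \<open>c = 0\<close> by (auto simp: P_def pq split: if_splits)
  qed
  define r where "r = smult (- inverse c) q"
  have "rel_poly R r r"
    using qK cK by (auto simp: rel_poly_def r_def intro!: R'(1) is_subfieldD[OF K] split: nat.split)
  then have rR: "(poly r a, poly r b) \<in> R" by (rule rel_poly_poly[OF K R ab])
  have "a * poly q a = - c" using val by (simp add: eq_neg_iff_add_eq_0 add.commute)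
  then have ra: "a * poly r a = 1" using \<open>c \<noteq> 0\<close>
    by (simp add: r_def mult.left_commute[of a "inverse c"])
  have "(1, b * poly r b) \<in> R" using R'(4)[OF ab rR] ra by simp
  moreover have "(1, 1) \<in> R" using R'(1) is_subfieldD(2)[OF K] by blast
  ultimately have rb: "b * poly r b = 1" by (rule R'(8))
  then show "b \<noteq> 0" by auto
  show "(inverse a, inverse b) \<in> R"
    using rR inverse_unique[OF ra] inverse_unique[OF rb] by simp
qed

text \<open>Divide \<open>p\<close> by \<open>m\<close> and \<open>q\<close> by \<open>m'\<close> in
  parallel, each step cancelling the leading term of \<open>p\<close>; a nonzero remainder of degree
  below \<open>m\<close> would contradict minimality. This makes sending values at \<open>x\<close>
  to values at \<open>y\<close> well defined.\<close>

lemma partial_hom_minimal_poly: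
  assumes K: "is_subfield K" and alg: "\<And>x. algebraic_over K x" and R: "partial_hom K R"
    and m: "rel_poly R m m'" "m \<noteq> 0" "poly m' y = 0"
    and min: "\<And>p q. rel_poly R p q \<Longrightarrow> p \<noteq> 0 \<Longrightarrow> poly p x = 0 \<Longrightarrow> degree m \<le> degree p"
    and mx: "poly m x = 0"
  shows "rel_poly R p q \<Longrightarrow> poly p x = 0 \<Longrightarrow> poly q y = 0"
proof (induction "degree p" arbitrary: p q rule: less_induct)
  case less
  note R' = partial_homD[OF K R]
  show ?case
  proof (cases "p = 0")
    case True
    have "q = 0"
      using less.prems True R'(7) by (intro poly_eqI) (auto simp: rel_poly_def)
    then show ?thesis by simp
  next
    case False
    have le: "degree m \<le> degree p" using min less.prems False by blast
    define N where "N = degree p - degree m"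
    define t where "t = lead_coeff p * inverse (lead_coeff m)"
    \<comment> \<open>Both coefficients are read at the degrees of \<open>p\<close> and
      \<open>m\<close>, not at those of \<open>q\<close> and \<open>m'\<close>, so that
      \<open>(t, t')\<close> is a pair of \<open>R\<close>.\<close>
    define t' where "t' = coeff q (degree p) * inverse (coeff m' (degree m))"
    have "(lead_coeff m, coeff m' (degree m)) \<in> R" using m(1) by (auto simp: rel_poly_def)
    from partial_hom_inverse[OF K R alg this] m(2)
    have "(t, t') \<in> R" using less.prems(1) unfolding t_def t'_def
      by (intro R'(4)) (auto simp: rel_poly_def)
    define p1 where "p1 = p - monom t N * m"
    define q1 where "q1 = q - monom t' N * m'"
    have rel: "rel_poly R p1 q1"
      unfolding p1_def q1_def using less.prems m \<open>(t, t') \<in> R\<close> by (intro rel_poly_ops[OF K R])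
    have v: "poly p1 x = 0" using less.prems mx by (simp add: p1_def)
    have "poly q1 y = 0"
    proof (cases "p1 = 0")
      case True
      have "q1 = 0" using rel True R'(7) by (intro poly_eqI) (auto simp: rel_poly_def)
      then show ?thesis by simp
    next
      case False
      have "t \<noteq> 0" using m \<open>p \<noteq> 0\<close> by (simp add: t_def)
      then have deg: "degree (monom t N * m) = degree p"
        using m le by (simp add: degree_mult_eq monom_eq_0_iff degree_monom_eq N_def)
      have lc: "coeff (monom t N * m) (degree p) = lead_coeff p"
        using m le by (simp add: coeff_monom_mult N_def t_def)
      have "coeff p1 (degree p) = 0" by (simp add: p1_def lc)
      moreover have "degree p1 \<le> degree p" unfolding p1_def using deg by (simp add: degree_diff_le)
      ultimately have "degree p1 < degree p"
        using False by (metis leading_coeff_0_iff nless_le)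
      then show ?thesis using less.hyps rel v by blast
    qed
    then show ?thesis using m by (simp add: q1_def)
  qed
qed

text \<open>The classical extension to a simple adjunction: related polynomials are evaluated at
  \<open>x\<close> and at \<open>y\<close>. Closure is polynomial arithmetic, and the kernel
  condition is the preceding division argument.\<close>

lemma partial_hom_adjoin:
  assumes K: "is_subfield K" and alg: "\<And>x. algebraic_over K x" and R: "partial_hom K R"
    and m: "rel_poly R m m'" "m \<noteq> 0" "poly m' y = 0"
    and min: "\<And>p q. rel_poly R p q \<Longrightarrow> p \<noteq> 0 \<Longrightarrow> poly p x = 0 \<Longrightarrow> degree m \<le> degree p"
    and mx: "poly m x = 0"
  shows "\<exists>R'. partial_hom K R' \<and> R \<subseteq> R' \<and> (x, y) \<in> R'"
proof -
  note R' = partial_homD[OF K R]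
  define S where "S = {(poly p x, poly q y) | p q. rel_poly R p q}"
  have RS: "(a, b) \<in> S" if "(a, b) \<in> R" for a b
  proof -
    have "rel_poly R [:a:] [:b:]" by (intro rel_poly_ops(5,7)[OF K R] that)
    then show ?thesis unfolding S_def by force
  qed
  have "rel_poly R [:0, 1:] [:0, 1:]"
    using R'(2) R'(1)[OF is_subfieldD(2)[OF K]] by (intro rel_poly_ops(5,7)[OF K R])
  then have "(x, y) \<in> S" unfolding S_def by force
  moreover have "partial_hom K S"
    unfolding partial_hom_def
  proof (intro conjI ballI allI impI)
    show "(c, c) \<in> S" if "c \<in> K" for c using RS R' that by blast
    show "(a + c, b + d) \<in> S" "(a * c, b * d) \<in> S"
      if ab: "(a, b) \<in> S" and cd: "(c, d) \<in> S" for a b c d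
    proof -
      obtain p q where pq: "rel_poly R p q" "a = poly p x" "b = poly q y"
        using ab unfolding S_def by blast
      obtain p' q' where pq': "rel_poly R p' q'" "c = poly p' x" "d = poly q' y"
        using cd unfolding S_def by blast
      have "(poly (p + p') x, poly (q + q') y) \<in> S" "(poly (p * p') x, poly (q * q') y) \<in> S"
        using rel_poly_ops(1,3)[OF K R pq(1) pq'(1)] unfolding S_def by blast+
      then show "(a + c, b + d) \<in> S" "(a * c, b * d) \<in> S" using pq pq' by simp_all
    qed
    show "z = 0" if "(0, z) \<in> S" for z
      using that partial_hom_minimal_poly[OF assms] unfolding S_def by force
  qed
  ultimately show ?thesis using RS by auto
qed

text \<open>Zorn's lemma gives a maximal extension \<open>M\<close>. It is total because any missing
  \<open>x\<close> could be adjoined, using a root of the image of its minimal polynomial;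
  injectivity and surjectivity then follow from algebraicity over \<open>K\<close>.\<close>

lemma partial_hom_extend:
  assumes K: "is_subfield K" and cl: "is_alg_closure_of K" and R: "partial_hom K R"
  shows "\<exists>g\<in>Aut_over K. \<forall>(a, b)\<in>R. g a = b"
proof -
  have alg: "algebraic_over K x" for x using cl by (simp add: is_alg_closure_of_def)
  have root: "\<exists>x. poly p x = 0" if "degree p > 0" for p :: "'a poly"
    using cl that by (simp add: is_alg_closure_of_def alg_closed_type_def)
  define \<A> where "\<A> = {S. partial_hom K S \<and> R \<subseteq> S}"
  have "\<exists>M\<in>\<A>. \<forall>X\<in>\<A>. M \<subseteq> X \<longrightarrow> X = M"
  proof (rule subset_Zorn_nonempty)
    show "\<A> \<noteq> {}" using R by (auto simp: \<A>_def)
    fix \<C> assume ne: "\<C> \<noteq> {}" and ch: "subset.chain \<A> \<C>"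
    have sub: "\<C> \<subseteq> \<A>" using ch by (simp add: subset.chain_def)
    \<comment> \<open>In a chain any two pairs of the union lie in one member, so the closure
      conditions pass to the union.\<close>
    have common: "\<exists>C\<in>\<C>. u \<in> C \<and> v \<in> C" if uv: "u \<in> \<Union>\<C>" "v \<in> \<Union>\<C>" for u v
    proof -
      obtain C D where CD: "C \<in> \<C>" "D \<in> \<C>" "u \<in> C" "v \<in> D" using uv by blast
      have "C \<subseteq> D \<or> D \<subseteq> C" using ch CD by (auto simp: subset_chain_def)
      then show ?thesis using CD by blast
    qed
    have "partial_hom K (\<Union>\<C>)"
      unfolding partial_hom_def
    proof (intro conjI ballI allI impI)
      show "(c, c) \<in> \<Union>\<C>" if "c \<in> K" for c
        using ne sub that unfolding \<A>_def partial_hom_def by blast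
      show "(a + c, b + d) \<in> \<Union>\<C>" "(a * c, b * d) \<in> \<Union>\<C>"
        if ab: "(a, b) \<in> \<Union>\<C>" "(c, d) \<in> \<Union>\<C>" for a b c d
      proof -
        obtain C where C: "C \<in> \<C>" "(a, b) \<in> C" "(c, d) \<in> C" using common[OF ab] by blast
        then have "partial_hom K C" using sub by (auto simp: \<A>_def)
        from partial_homD(3,4)[OF K this C(2,3)] C(1)
        show "(a + c, b + d) \<in> \<Union>\<C>" "(a * c, b * d) \<in> \<Union>\<C>" by auto
      qed
      show "y = 0" if "(0, y) \<in> \<Union>\<C>" for y
        using sub that unfolding \<A>_def partial_hom_def by blast
    qed
    moreover have "R \<subseteq> \<Union>\<C>" using ne sub by (auto simp: \<A>_def)
    ultimately show "\<Union>\<C> \<in> \<A>" by (simp add: \<A>_def)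
  qed
  then obtain M where "M \<in> \<A>" and M_max: "\<forall>X\<in>\<A>. M \<subseteq> X \<longrightarrow> X = M" ..
  then have M: "partial_hom K M" "R \<subseteq> M" by (simp_all add: \<A>_def)
  have max: "X = M" if "partial_hom K X" "M \<subseteq> X" for X
    using M_max M(2) that by (simp add: \<A>_def subset_trans[of R M X])
  note M' = partial_homD[OF K M(1)]
  have total: "\<exists>y. (x, y) \<in> M" for x
  proof -
    \<comment> \<open>A least such pair consists of a minimal polynomial of \<open>x\<close> over
      the domain of \<open>M\<close> and its image.\<close>
    define P where "P pq \<longleftrightarrow> rel_poly M (fst pq) (snd pq) \<and> fst pq \<noteq> 0 \<and> poly (fst pq) x = 0" for pq
    obtain p where "p \<noteq> 0" "\<forall>i. coeff p i \<in> K" "poly p x = 0"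
      using alg[of x] by (auto simp: algebraic_over_def)
    then have "P (p, p)" by (auto simp: P_def rel_poly_def intro: M')
    then obtain mm where mm: "P mm" "\<And>q. P q \<Longrightarrow> degree (fst mm) \<le> degree (fst q)"
      using ex_has_least_nat[of P _ "\<lambda>q. degree (fst q)"] by blast
    define m m' where "m = fst mm" and "m' = snd mm"
    have m: "rel_poly M m m'" "m \<noteq> 0" "poly m x = 0"
      using mm(1) by (auto simp: P_def m_def m'_def)
    have min: "degree m \<le> degree p" if "rel_poly M p q" "p \<noteq> 0" "poly p x = 0" for p q
      using mm(2)[of "(p, q)"] that by (simp add: P_def m_def)
    have "degree m > 0"
    proof (rule ccontr)
      assume "\<not> degree m > 0"
      then obtain c where "m = [:c:]" using degree_eq_zeroE by blast
      then show False using m by simp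
    qed
    \<comment> \<open>A nonzero leading coefficient has nonzero image, so \<open>m'\<close> is
      nonconstant and has a root in the algebraically closed field.\<close>
    have "(lead_coeff m, coeff m' (degree m)) \<in> M" using m(1) by (auto simp: rel_poly_def)
    from partial_hom_inverse(1)[OF K M(1) alg this] m(2) have "coeff m' (degree m) \<noteq> 0" by simp
    then have "degree m' > 0" using \<open>degree m > 0\<close> le_degree by fastforce
    then obtain y where y: "poly m' y = 0" using root by blast
    have "\<exists>X. partial_hom K X \<and> M \<subseteq> X \<and> (x, y) \<in> X"
      by (rule partial_hom_adjoin[OF K alg M(1) m(1,2) y _ m(3)]) (rule min)
    then show ?thesis using max by blast
  qed
  define g where "g x = (SOME y. (x, y) \<in> M)" for x
  have gM: "(x, g x) \<in> M" for x unfolding g_def using someI_ex[OF total] .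
  have g_eq: "g a = b" if "(a, b) \<in> M" for a b using M'(8)[OF gM that] .
  have hom: "g (x + y) = g x + g y" "g (x * y) = g x * g y" "g (x - y) = g x - g y" for x y
    by (intro g_eq M' gM)+
  have gK: "g x = x" if "x \<in> K" for x using that by (intro g_eq M')
  have inj: "inj g"
  proof (rule injI)
    fix x y assume "g x = g y"
    then have "(x - y, 0) \<in> M" using gM[of "x - y"] by (simp add: hom)
    from partial_hom_inverse(1)[OF K M(1) alg this] show "x = y" by auto
  qed
  have "surj g"
    unfolding surj_def
  proof
    fix y
    obtain p where p: "p \<noteq> 0" "\<forall>i. coeff p i \<in> K" "poly p y = 0"
      using alg[of y] by (auto simp: algebraic_over_def)
    have pM: "rel_poly M p p" using p by (auto simp: rel_poly_def intro: M')
    \<comment> \<open>Since \<open>p\<close> has coefficients in \<open>K\<close>, \<open>g\<close>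
      maps its finite zero set injectively into itself, hence onto itself.\<close>
    let ?Z = "{z. poly p z = 0}"
    have "poly p (g z) = 0" if "poly p z = 0" for z
      using M'(7) rel_poly_poly[OF K M(1) gM[of z] pM] that by simp
    then have "g ` ?Z = ?Z"
      using inj p(1) by (intro endo_inj_surj poly_roots_finite) (auto intro: inj_on_subset)
    then show "\<exists>x. y = g x" using p(3) by blast
  qed
  then have "g \<in> Aut_over K" using inj hom gK by (simp add: Aut_over_def bij_def)
  then show ?thesis using g_eq M(2) by blast
qed

section \<open>The fixed field and the degree of the composite\<close>

text \<open>This is separability over a perfect field. A derivative vanishing at \<open>x\<close> is
  zero by minimality, which forces positive characteristic \<open>l\<close>; roots of order
  \<open>l\<close> of the coefficients then yield a polynomial of smaller degree vanishing at
  \<open>x\<close>.\<close>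

lemma perfect_minimal_poly_pderiv:
  fixes K :: "'a::field set"
  assumes perf: "perfect_subfield K"
    and m: "\<forall>i. coeff m i \<in> K" "degree m > 0" "poly m x = 0"
    and min: "\<And>p. \<forall>i. coeff p i \<in> K \<Longrightarrow> p \<noteq> 0 \<Longrightarrow> poly p x = 0 \<Longrightarrow> degree m \<le> degree p"
  shows "poly (pderiv m) x \<noteq> 0"
proof
  have K: "is_subfield K" using perf by (simp add: perfect_subfield_def)
  assume 0: "poly (pderiv m) x = 0"
  have ofnat: "of_nat n \<in> K" for n
    by (induction n) (auto intro: is_subfieldD[OF K])
  have "\<forall>i. coeff (pderiv m) i \<in> K"
    unfolding coeff_pderiv using m(1) ofnat is_subfieldD(4)[OF K] by blast
  moreover have deg: "degree (pderiv m) < degree m"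
  proof -
    have "degree (pderiv m) \<le> degree m - 1"
      using m(2) by (intro degree_le) (auto simp: coeff_pderiv coeff_eq_0)
    then show ?thesis using m(2) by linarith
  qed
  ultimately have pd0: "pderiv m = 0" using min 0 by fastforce
  have coef: "of_nat (Suc i) * coeff m (Suc i) = 0" for i
    using pd0 coeff_pderiv[of m i] by simp
  define l where "l = CHAR('a)"
  \<comment> \<open>The leading coefficient of the zero derivative is the degree times the nonzero
    leading coefficient of \<open>m\<close>.\<close>
  have "of_nat (degree m) = (0 :: 'a)"
    using coef[of "degree m - 1"] m(2) by auto
  then have ldvd: "l dvd degree m" by (simp add: l_def of_nat_eq_0_iff_char_dvd)
  then have "l > 0" using m(2) by (cases "l = 0") auto
  then have l: "prime l" unfolding l_def by (intro prime_CHAR_semidom) auto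
  then have "l > 1" by (rule prime_gt_1_nat)
  have "\<forall>x\<in>K. \<exists>y\<in>K. y ^ l = x"
    using perf \<open>l > 0\<close> by (auto simp: perfect_subfield_def l_def)
  then obtain r where r: "\<And>x. x \<in> K \<Longrightarrow> r x \<in> K" "\<And>x. x \<in> K \<Longrightarrow> r x ^ l = x" by metis
  define N where "N = degree m div l"
  have N: "degree m = l * N" using ldvd by (simp add: N_def)
  \<comment> \<open>If the derivative vanishes, then \<open>m = q\<^sup>l\<close> with \<open>q\<close> over \<open>K\<close>, contradicting minimality.\<close>
  define q where "q = (\<Sum>j\<le>N. monom (r (coeff m (l * j))) j)"
  have cq: "coeff q j = (if j \<le> N then r (coeff m (l * j)) else 0)" for j
    by (simp add: q_def coeff_sum coeff_monom sum.delta)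
  have "poly q x ^ l = (\<Sum>j\<le>N. (r (coeff m (l * j)) * x ^ j) ^ l)"
    unfolding q_def poly_sum poly_monom using l by (intro freshmans_dream_sum) (auto simp: l_def)
  also have "\<dots> = (\<Sum>j\<le>N. coeff m (l * j) * x ^ (l * j))"
    using m(1) r(2) by (intro sum.cong) (auto simp: power_mult_distrib mult.commute simp flip: power_mult)
  also have "\<dots> = (\<Sum>i\<in>(*) l ` {..N}. coeff m i * x ^ i)"
    using \<open>l > 0\<close> by (subst sum.reindex) (auto simp: inj_on_def)
  \<comment> \<open>Exponents not divisible by \<open>l\<close> contribute nothing, as the zero
    derivative kills their coefficients.\<close>
  also have "\<dots> = (\<Sum>i\<le>degree m. coeff m i * x ^ i)"
  proof (rule sum.mono_neutral_left)
    show "(*) l ` {..N} \<subseteq> {..degree m}" using N by auto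
    show "\<forall>i\<in>{..degree m} - (*) l ` {..N}. coeff m i * x ^ i = 0"
    proof
      fix i assume i: "i \<in> {..degree m} - (*) l ` {..N}"
      have "\<not> l dvd i"
      proof
        assume "l dvd i"
        then obtain j where "i = l * j" by (elim dvdE)
        then show False using i N \<open>l > 0\<close> by auto
      qed
      then have "i > 0" "of_nat i \<noteq> (0 :: 'a)"
        by (auto intro: gr0I simp: l_def of_nat_eq_0_iff_char_dvd)
      then show "coeff m i * x ^ i = 0" using coef[of "i - 1"] by simp
    qed
  qed auto
  also have "\<dots> = 0" using m(3) by (simp add: poly_altdef)
  finally have "poly q x = 0" using \<open>l > 0\<close> by simp
  moreover have "\<forall>i. coeff q i \<in> K" using m(1) r(1) is_subfieldD(1)[OF K] by (simp add: cq)
  moreover have "q \<noteq> 0"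
  proof
    assume "q = 0"
    then have "r (lead_coeff m) = 0" using cq[of N] N by simp
    then have "lead_coeff m = 0" using r(2)[of "lead_coeff m"] m(1) \<open>l > 0\<close> by (auto simp: power_0_left)
    then show False using m(2) by auto
  qed
  ultimately have "degree m \<le> degree q" using min by blast
  also have "degree q \<le> N" by (intro degree_le) (simp add: cq)
  finally show False using N \<open>l > 1\<close> m(2) by simp
qed

text \<open>An \<open>x\<close> outside \<open>K\<close> has a minimal polynomial of degree at least
  two in which \<open>x\<close> is a simple root. It therefore has another root \<open>y\<close>,
  and sending \<open>x\<close> to \<open>y\<close> extends to an automorphism that moves
  \<open>x\<close>.\<close>

lemma perfect_fixed_field:
  fixes K :: "'a::field set"
  assumes perf: "perfect_subfield K" and cl: "is_alg_closure_of K"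
    and fixed: "\<And>g. g \<in> Aut_over K \<Longrightarrow> g x = x"
  shows "x \<in> K"
proof (rule ccontr)
  assume x: "x \<notin> K"
  have K: "is_subfield K" using perf by (simp add: perfect_subfield_def)
  have alg: "algebraic_over K x" for x using cl by (simp add: is_alg_closure_of_def)
  \<comment> \<open>For the identity of \<open>K\<close>, related polynomials are equal polynomials
    over \<open>K\<close>, so minimality over \<open>K\<close> is what adjunction requires.\<close>
  have R: "partial_hom K (Id_on K)"
    by (auto simp: partial_hom_def intro: is_subfieldD[OF K])
  have rel: "rel_poly (Id_on K) p q \<longleftrightarrow> p = q \<and> (\<forall>i. coeff p i \<in> K)" for p q
    by (auto simp: rel_poly_def Id_on_iff poly_eq_iff)
  define P where "P p \<longleftrightarrow> p \<noteq> 0 \<and> (\<forall>i. coeff p i \<in> K) \<and> poly p x = 0" for p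
  have "\<exists>p. P p" using alg[of x] unfolding algebraic_over_def P_def .
  then obtain m where m: "P m" and min: "\<And>q. P q \<Longrightarrow> degree m \<le> degree q"
    using ex_has_least_nat[of P _ degree] by blast
  obtain r where r: "m = [:- x, 1:] * r" using m by (auto simp: P_def poly_eq_0_iff_dvd)
  then have "r \<noteq> 0" using m by (auto simp: P_def)
  then have deg: "degree m = Suc (degree r)" unfolding r by (subst degree_mult_eq) auto
  have "poly (pderiv m) x \<noteq> 0"
    using m min deg by (intro perfect_minimal_poly_pderiv[OF perf]) (auto simp: P_def)
  \<comment> \<open>By the product rule, the derivative of \<open>(X - x) r\<close> takes the value
    \<open>r(x)\<close> at \<open>x\<close>.\<close>
  moreover have "poly (pderiv m) x = poly r x"
    unfolding r pderiv_mult by (simp add: pderiv_pCons)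
  ultimately have rx: "poly r x \<noteq> 0" by simp
  have "degree r > 0"
  proof (rule ccontr)
    assume "\<not> degree r > 0"
    then obtain c where c: "r = [:c:]" using degree_eq_zeroE by blast
    then have mc: "coeff m 0 = - x * c" "coeff m 1 = c" "c \<noteq> 0" using \<open>r \<noteq> 0\<close> by (auto simp: r)
    have "- coeff m 0 / coeff m 1 \<in> K"
      using m unfolding P_def by (intro is_subfieldD[OF K]) blast+
    then show False using mc x by simp
  qed
  then obtain y where y: "poly r y = 0"
    using cl by (auto simp: is_alg_closure_of_def alg_closed_type_def)
  then have "poly m y = 0" by (simp add: r)
  then obtain S where S: "partial_hom K S" "(x, y) \<in> S"
    using partial_hom_adjoin[OF K alg R, of m m y x] m min by (auto simp: rel P_def)
  obtain g where "g \<in> Aut_over K" "g x = y"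
    using partial_hom_extend[OF K cl S(1)] S(2) by auto
  then show False using fixed rx y by metis
qed

section \<open>Artin's theorem for restrictions of automorphisms\<close>

lemma Aut_overD:
  assumes "g \<in> Aut_over K"
  shows "bij g" "g (x + y) = g x + g y" "g (x * y) = g x * g y" "\<And>x. x \<in> K \<Longrightarrow> g x = x"
    "g 0 = 0" "g 1 = 1" "g (sum f A) = (\<Sum>i\<in>A. g (f i))"
proof -
  show *: "bij g" "g (x + y) = g x + g y" "g (x * y) = g x * g y" "\<And>x. x \<in> K \<Longrightarrow> g x = x"
    for x y using assms by (auto simp: Aut_over_def)
  show 0: "g 0 = 0" using *(2)[of 0 0] by (metis add_0 add_left_cancel add.right_neutral)
  have "g 1 \<noteq> g 0" using *(1) by (metis bij_def inj_eq zero_neq_one)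
  then show "g 1 = 1" using *(3)[of 1 1] 0 by simp
  show "g (sum f A) = (\<Sum>i\<in>A. g (f i))"
    by (induction A rule: infinite_finite_induct) (auto simp: 0 *)
qed

lemma Aut_over_comp:
  "g \<in> Aut_over K \<Longrightarrow> h \<in> Aut_over K \<Longrightarrow> g \<circ> h \<in> Aut_over K"
  by (auto simp: Aut_over_def bij_comp)

lemma Aut_over_inv:
  assumes "g \<in> Aut_over K"
  shows "inv g \<in> Aut_over K"
proof -
  note g = Aut_overD[OF assms]
  have "inv g (x + y) = inv g x + inv g y" "inv g (x * y) = inv g x * inv g y" for x y
    using g(1-3) by (metis bij_inv_eq_iff)+
  then show ?thesis
    using g(1,4) by (auto simp: Aut_over_def bij_imp_bij_inv) (metis bij_inv_eq_iff)
qed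

text \<open>Evaluating the relation at \<open>y * x\<close> and subtracting \<open>s y\<close> times
  the relation at \<open>x\<close> eliminates \<open>s\<close>. Extensionality supplies a
  \<open>y\<close> in \<open>F\<close> at which \<open>u\<close> and \<open>s\<close> differ, so
  \<open>d u = 0\<close> by induction; evaluation at \<open>1\<close> then gives
  \<open>d s = 0\<close>.\<close>

lemma dedekind_independence:
  assumes "finite T" and F: "1 \<in> F" "\<And>x y. x \<in> F \<Longrightarrow> y \<in> F \<Longrightarrow> x * y \<in> F"
    and T: "\<And>t. t \<in> T \<Longrightarrow> t \<in> extensional F \<and> t 1 = (1::'b::field) \<and> (\<forall>x\<in>F. \<forall>y\<in>F. t (x * y) = t x * t y)"
    and "\<And>x. x \<in> F \<Longrightarrow> (\<Sum>t\<in>T. d t * t x) = 0"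
    and "t \<in> T"
  shows "d t = 0"
  using assms(1,4,5,6)
proof (induction T arbitrary: d t rule: finite_induct)
  case (insert s T)
  have "d u = 0" if u: "u \<in> T" for u
  proof -
    have "u \<noteq> s" using u insert.hyps by auto
    then obtain y where y: "y \<in> F" "u y \<noteq> s y"
      using insert.prems(1)[of u] insert.prems(1)[of s] u extensionalityI[of u F s] by blast
    have "(\<Sum>t\<in>T. (d t * (t y - s y)) * t x) = 0" if x: "x \<in> F" for x
    proof -
      have "(\<Sum>t\<in>T. d t * t (y * x)) = (\<Sum>t\<in>T. d t * t y * t x)"
        using insert.prems(1) x y by (intro sum.cong) auto
      moreover have "s (y * x) = s y * s x" using insert.prems(1) x y by simp
      ultimately have "d s * (s y * s x) + (\<Sum>t\<in>T. d t * t y * t x) = 0"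
        using insert.prems(2)[OF F(2)[OF y(1) x]] insert.hyps by simp
      moreover have "s y * (d s * s x + (\<Sum>t\<in>T. d t * t x)) = 0"
        using insert.prems(2)[OF x] insert.hyps by simp
      then have "d s * (s y * s x) + (\<Sum>t\<in>T. d t * s y * t x) = 0"
        by (simp add: distrib_left sum_distrib_left mult_ac)
      ultimately have "d s * (s y * s x) + (\<Sum>t\<in>T. d t * t y * t x) =
          d s * (s y * s x) + (\<Sum>t\<in>T. d t * s y * t x)" by (rule trans[OF _ sym])
      then have "(\<Sum>t\<in>T. d t * t y * t x) = (\<Sum>t\<in>T. d t * s y * t x)"
        by (rule add_left_imp_eq)
      then show ?thesis
        by (simp add: left_diff_distrib right_diff_distrib sum_subtractf)
    qed
    then have "d u * (u y - s y) = 0"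
      using insert.prems(1) u by (intro insert.IH[where d = "\<lambda>t. d t * (t y - s y)"]) auto
    then show ?thesis using y by simp
  qed
  moreover have "d s = 0"
    using insert.prems(2)[OF F(1)] insert.prems(1)[of s] insert.hyps calculation by simp
  ultimately show ?case using insert.prems(3) by blast
qed simp

text \<open>Artin's theorem in a form without a Galois group of \<open>F\<close>: the restrictions
  may leave \<open>F\<close>, but \<open>T\<close> is stable under composition with
  \<open>Aut_over K\<close> on the left, and this permutes the entries of the value vectors.\<close>

lemma has_dim_card_restrictions:
  fixes K F :: "'a::field set"
  assumes perf: "perfect_subfield K" and cl: "is_alg_closure_of K"
    and F: "is_subfield F" and KF: "K \<subseteq> F"
    and T: "T = {restrict g F | g. g \<in> Aut_over K}" and fin: "finite T"
  shows "has_dim K (\<lambda>a v. a * v) (+) 0 F (card T)"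
proof -
  have K: "is_subfield K" using perf by (simp add: perfect_subfield_def)
  have T_K: "t x = x" if "t \<in> T" "x \<in> K" for t x
    using that KF by (auto simp: T Aut_overD(4))
  have T_sum: "t (\<Sum>j<r. c j * x j) = (\<Sum>j<r. c j * t (x j))"
    if t: "t \<in> T" and "\<And>j. j < r \<Longrightarrow> c j \<in> K" "\<And>j. j < r \<Longrightarrow> x j \<in> F" for t c x and r :: nat
  proof -
    have "(\<Sum>j<r. c j * x j) \<in> F"
      using that KF by (intro is_subfield_sum[OF F] is_subfieldD(4)[OF F]) auto
    moreover obtain g where g: "g \<in> Aut_over K" "t = restrict g F" using t T by blast
    ultimately have "t (\<Sum>j<r. c j * x j) = (\<Sum>j<r. g (c j * x j))"
      by (simp add: Aut_overD(7))
    also have "\<dots> = (\<Sum>j<r. c j * t (x j))"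
      using that g by (intro sum.cong) (auto simp: Aut_overD(3,4))
    finally show ?thesis .
  qed
  have T_comp: "restrict (g \<circ> t) F \<in> T" if t: "t \<in> T" and g: "g \<in> Aut_over K" for t g
  proof -
    obtain h where "h \<in> Aut_over K" "t = restrict h F" using t T by blast
    moreover from this have "restrict (g \<circ> t) F = restrict (g \<circ> h) F" by (auto simp: fun_eq_iff)
    ultimately show ?thesis using g Aut_over_comp T by blast
  qed
  \<comment> \<open>A family \<open>x\<close> of maximal length with independent value vectors \<open>(t (x j))\<close> will be a basis: coefficients
    of a value vector are unique, hence fixed by \<open>Aut_over K\<close>, hence in \<open>K\<close>.\<close>
  define ind where "ind r x \<longleftrightarrow> (\<forall>j<r. x j \<in> F) \<and>
     (\<forall>c. (\<forall>t\<in>T. (\<Sum>j<r. c j * t (x j)) = 0) \<longrightarrow> (\<forall>j<r. c j = 0))" for r :: nat and x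
  \<comment> \<open>Value vectors have \<open>card T\<close> entries, so a longer family is
    dependent over the ambient field.\<close>
  have bound: "r \<le> card T" if "ind r x" for r x
  proof (rule ccontr)
    assume "\<not> r \<le> card T"
    then have "\<exists>c. (\<forall>j\<in>{..<r}. c j \<in> UNIV) \<and> (\<exists>j\<in>{..<r}. c j \<noteq> 0) \<and>
        (\<forall>t\<in>T. (\<Sum>j\<in>{..<r}. t (x j) * c j) = 0)"
      by (intro underdetermined_system is_subfield_UNIV fin) auto
    then show False using that by (auto simp: ind_def mult.commute)
  qed
  have "\<exists>x. ind 0 x" by (auto simp: ind_def)
  then have "\<exists>r. (\<exists>x. ind r x) \<and> (\<forall>s. (\<exists>x. ind s x) \<longrightarrow> id s \<le> id r)"
    using bound by (intro ex_has_greatest_nat[where b = "Suc (card T)"]) (auto simp: less_Suc_eq_le)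
  then obtain r x where x: "ind r x" and max: "\<And>s x. ind s x \<Longrightarrow> s \<le> r"
    by auto
  have xF: "x j \<in> F" if "j < r" for j using x that by (simp add: ind_def)
  have indep: "c j = 0" if "\<And>t. t \<in> T \<Longrightarrow> (\<Sum>j<r. c j * t (x j)) = 0" "j < r" for c j
    using x that by (auto simp: ind_def)
  have span: "\<exists>c. \<forall>t\<in>T. t v = (\<Sum>j<r. c j * t (x j))" if v: "v \<in> F" for v
  proof -
    \<comment> \<open>Appending \<open>v\<close> to a maximal family creates a relation; the
      coefficient of \<open>v\<close> cannot vanish, so the relation can be solved for the values of
      \<open>v\<close>.\<close>
    have "\<not> ind (Suc r) (x(r := v))" using max[of "Suc r"] by fastforce
    then obtain c where c: "\<And>t. t \<in> T \<Longrightarrow> (\<Sum>j<Suc r. c j * t ((x(r := v)) j)) = 0"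
      and ex: "\<exists>j<Suc r. c j \<noteq> 0"
      using v xF unfolding ind_def by (auto simp: less_Suc_eq)
    have c': "(\<Sum>j<r. c j * t (x j)) + c r * t v = 0" if "t \<in> T" for t
      using c[OF that] by simp
    have "c r \<noteq> 0"
    proof
      assume cr: "c r = 0"
      then have "c j = 0" if "j < r" for j using c' cr that by (intro indep[of c]) auto
      then show False using ex cr by (auto simp: less_Suc_eq)
    qed
    have "t v = (\<Sum>j<r. (- c j / c r) * t (x j))" if "t \<in> T" for t
    proof -
      have "(\<Sum>j<r. (- c j / c r) * t (x j)) = - (\<Sum>j<r. c j * t (x j)) / c r"
        by (simp add: sum_divide_distrib sum_negf)
      also have "\<dots> = t v" using iffD2[OF eq_neg_iff_add_eq_0 c'[OF that]] \<open>c r \<noteq> 0\<close> by simp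
      finally show ?thesis ..
    qed
    then show ?thesis by (intro exI[of _ "\<lambda>j. - c j / c r"]) blast
  qed
  \<comment> \<open>Otherwise some nontrivial combination of the members of \<open>T\<close>
    vanishes on all \<open>x j\<close>, hence on \<open>F\<close> by \<open>span\<close>, against
    Dedekind's theorem.\<close>
  have "card T \<le> r"
  proof (rule ccontr)
    assume "\<not> card T \<le> r"
    then have "\<exists>d. (\<forall>t\<in>T. d t \<in> UNIV) \<and> (\<exists>t\<in>T. d t \<noteq> 0) \<and>
        (\<forall>j\<in>{..<r}. (\<Sum>t\<in>T. t (x j) * d t) = 0)"
      by (intro underdetermined_system is_subfield_UNIV fin) auto
    then obtain d where d: "\<exists>t\<in>T. d t \<noteq> 0" "\<And>j. j < r \<Longrightarrow> (\<Sum>t\<in>T. t (x j) * d t) = 0"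
      by auto
    have "(\<Sum>t\<in>T. d t * t v) = 0" if v: "v \<in> F" for v
    proof -
      obtain c where c: "\<And>t. t \<in> T \<Longrightarrow> t v = (\<Sum>j<r. c j * t (x j))" using span[OF v] by blast
      have "(\<Sum>t\<in>T. d t * t v) = (\<Sum>t\<in>T. \<Sum>j<r. d t * (c j * t (x j)))"
        by (intro sum.cong) (auto simp: c sum_distrib_left)
      also have "\<dots> = (\<Sum>j<r. \<Sum>t\<in>T. d t * (c j * t (x j)))" by (rule sum.swap)
      also have "\<dots> = (\<Sum>j<r. c j * (\<Sum>t\<in>T. t (x j) * d t))"
        by (simp add: sum_distrib_left mult_ac)
      also have "\<dots> = 0" using d(2) by simp
      finally show ?thesis .
    qed
    then have "d t = 0" if "t \<in> T" for t
      using that F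
      by (intro dedekind_independence[OF fin, of F d])
         (auto simp: T is_subfieldD Aut_overD(3,6))
    then show False using d(1) by blast
  qed
  then have r: "r = card T" using bound[OF x] by simp
  \<comment> \<open>The identity is the entry of the value vectors from which \<open>v\<close>
    itself is recovered.\<close>
  have "restrict id F \<in> T" by (auto simp: T Aut_over_def)
  have basis: "(\<forall>j<r. x j \<in> F) \<and>
     (\<forall>v\<in>F. \<exists>c. (\<forall>j<r. c j \<in> K) \<and> v = (\<Sum>j<r. c j * x j)) \<and>
     (\<forall>c. (\<forall>j<r. c j \<in> K) \<and> (\<Sum>j<r. c j * x j) = 0 \<longrightarrow> (\<forall>j<r. c j = 0))"
  proof (intro conjI ballI allI impI)
    fix v assume v: "v \<in> F"
    obtain c where c: "\<And>t. t \<in> T \<Longrightarrow> t v = (\<Sum>j<r. c j * t (x j))" using span[OF v] by blast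
    have "c j \<in> K" if j: "j < r" for j
    proof (rule perfect_fixed_field[OF perf cl])
      fix g assume g: "g \<in> Aut_over K"
      have "(\<Sum>j<r. (g (c j) - c j) * t (x j)) = 0" if t: "t \<in> T" for t
      proof -
        \<comment> \<open>Applying \<open>g\<close> to the relation for \<open>s\<close> yields one
          for \<open>t\<close> with coefficients \<open>g (c j)\<close>; uniqueness of the
          coefficients gives \<open>g (c j) = c j\<close>.\<close>
        define s where "s = restrict (inv g \<circ> t) F"
        have s: "s \<in> T" unfolding s_def by (intro T_comp t Aut_over_inv g)
        have gs: "g (s u) = t u" if "u \<in> F" for u
          using that Aut_overD(1)[OF g] by (simp add: s_def bij_is_surj surj_f_inv_f)
        have "t v = g (\<Sum>j<r. c j * s (x j))" using c[OF s] gs[OF v] by simp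
        also have "\<dots> = (\<Sum>j<r. g (c j) * t (x j))"
          by (simp add: Aut_overD(3,7)[OF g] gs xF)
        finally show ?thesis using c[OF t] by (simp add: left_diff_distrib sum_subtractf)
      qed
      then show "g (c j) = c j" using indep[of "\<lambda>j. g (c j) - c j" j] j by simp
    qed
    moreover have "v = (\<Sum>j<r. c j * x j)"
      using c[OF \<open>restrict id F \<in> T\<close>] v xF by simp
    ultimately show "\<exists>c. (\<forall>j<r. c j \<in> K) \<and> v = (\<Sum>j<r. c j * x j)" by blast
  next
    fix c j assume c: "(\<forall>j<r. c j \<in> K) \<and> (\<Sum>j<r. c j * x j) = 0" and j: "j < r"
    \<comment> \<open>A relation over \<open>K\<close> is preserved by every \<open>t\<close>, so it
      is a relation between value vectors.\<close>
    show "c j = 0"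
    proof (rule indep[of c, OF _ j])
      fix t assume t: "t \<in> T"
      have "(\<Sum>j<r. c j * t (x j)) = t (\<Sum>j<r. c j * x j)"
        using T_sum[OF t, of r c x] c xF by simp
      also have "\<dots> = 0" using c T_K[OF t] is_subfieldD(1)[OF K] by simp
      finally show "(\<Sum>j<r. c j * t (x j)) = 0" .
    qed
  qed (use xF in auto)
  show ?thesis
    unfolding has_dim_iff_sum[OF K is_subfieldD(1)[OF F]] using basis unfolding r by blast
qed

section \<open>Algebraic elements and images under field homomorphisms\<close>

text \<open>The powers of \<open>x\<close> with exponents \<open>0\<close> to \<open>m\<close> are
  \<open>m + 1\<close> vectors in an \<open>m\<close>-dimensional space; a relation between their
  coordinates \<open>C\<close> is the required polynomial.\<close>

lemma algebraic_over_of_has_dim: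
  assumes L: "is_subfield L" and F: "is_subfield F" and dim: "has_dim L (\<lambda>a v. a * v) (+) 0 F m"
    and x: "x \<in> F"
  shows "algebraic_over L x"
proof -
  obtain b where span: "\<forall>v\<in>F. \<exists>c. (\<forall>i<m. c i \<in> L) \<and> v = (\<Sum>i<m. c i * b i)"
    using dim unfolding has_dim_iff_sum[OF L is_subfieldD(1)[OF F]] by (elim exE conjE)
  have "\<forall>j. \<exists>c. (\<forall>i<m. c i \<in> L) \<and> x ^ j = (\<Sum>i<m. c i * b i)"
    by (intro allI span[rule_format] is_subfield_power F x)
  then obtain C where C: "\<And>i j. i < m \<Longrightarrow> C j i \<in> L" "\<And>j. x ^ j = (\<Sum>i<m. C j i * b i)"
    by metis
  have "\<exists>d. (\<forall>j\<in>{..m}. d j \<in> L) \<and> (\<exists>j\<in>{..m}. d j \<noteq> 0) \<and> (\<forall>i\<in>{..<m}. (\<Sum>j\<in>{..m}. C j i * d j) = 0)"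
    using C by (intro underdetermined_system L) auto
  then obtain d where d: "\<And>j. j \<le> m \<Longrightarrow> d j \<in> L" "\<exists>j\<le>m. d j \<noteq> 0"
    "\<And>i. i < m \<Longrightarrow> (\<Sum>j\<le>m. C j i * d j) = 0" by auto
  define p where "p = (\<Sum>j\<le>m. monom (d j) j)"
  have cp: "coeff p j = (if j \<le> m then d j else 0)" for j
    by (simp add: p_def coeff_sum coeff_monom sum.delta)
  have "poly p x = (\<Sum>j\<le>m. d j * (\<Sum>i<m. C j i * b i))"
    by (simp add: p_def poly_sum poly_monom C(2)[symmetric])
  also have "\<dots> = (\<Sum>j\<le>m. \<Sum>i<m. d j * (C j i * b i))" by (simp add: sum_distrib_left)
  also have "\<dots> = (\<Sum>i<m. \<Sum>j\<le>m. d j * (C j i * b i))" by (rule sum.swap)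
  also have "\<dots> = (\<Sum>i<m. (\<Sum>j\<le>m. C j i * d j) * b i)"
    by (simp add: sum_distrib_left sum_distrib_right mult_ac)
  also have "\<dots> = 0" using d(3) by simp
  finally have "poly p x = 0" .
  moreover have "p \<noteq> 0" using d(2) cp by (metis coeff_0)
  moreover have "\<forall>i. coeff p i \<in> L" using d(1) is_subfieldD(1)[OF L] by (simp add: cp)
  ultimately show ?thesis unfolding algebraic_over_def by blast
qed

lemma hom_sum:
  assumes "h 0 = 0" "\<And>x y. h (x + y) = h x + h y"
  shows "h (sum f A) = (\<Sum>i\<in>A. h (f i))"
  by (induction A rule: infinite_finite_induct) (auto simp: assms)

lemma map_poly_hom_mult:
  fixes h :: "'a::field \<Rightarrow> 'b::field"
  assumes "h 0 = 0" "\<And>x y. h (x + y) = h x + h y" "\<And>x y. h (x * y) = h x * h y"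
  shows "map_poly h (p * q) = map_poly h p * map_poly h q"
  by (intro poly_eqI) (simp add: coeff_map_poly assms coeff_mult hom_sum[of h])

text \<open>The image of an algebraically closed field is algebraically closed. Pull the polynomial
  back along \<open>h\<close> and split off linear factors in the domain; \<open>y\<close> must be
  the image of one of the roots.\<close>

lemma algebraic_over_range:
  fixes h :: "'a::field \<Rightarrow> 'b::field"
  assumes h: "h 0 = 0" "h 1 = 1" "\<And>x y. h (x + y) = h x + h y" "\<And>x y. h (x * y) = h x * h y"
    and cl: "alg_closed_type TYPE('a)" and y: "algebraic_over (range h) y"
  shows "y \<in> range h"
proof -
  have h_eq_0: "x = 0" if "h x = 0" for x
  proof (rule ccontr)
    assume "x \<noteq> 0"
    then have "h x * h (inverse x) = 1" using h(2) h(4)[of x "inverse x"] by simp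
    then show False using that by simp
  qed
  have h_minus: "h (- x) = - h x" for x
    using h(1) h(3)[of x "- x"] by (simp add: eq_neg_iff_add_eq_0 add.commute)
  have roots: "y \<in> range h" if "q \<noteq> 0" "poly (map_poly h q) y = 0" for q
    using that
  proof (induction "degree q" arbitrary: q rule: less_induct)
    case less
    have "degree q > 0"
    proof (rule ccontr)
      assume "\<not> degree q > 0"
      then obtain c where "q = [:c:]" using degree_eq_zeroE by blast
      then show False using less.prems h_eq_0 by (auto simp: map_poly_pCons h(1))
    qed
    then obtain r where "poly q r = 0" using cl by (auto simp: alg_closed_type_def)
    then obtain q' where q': "q = [:- r, 1:] * q'" by (auto simp: poly_eq_0_iff_dvd)
    then have "q' \<noteq> 0" using less.prems by auto
    then have deg: "degree q = Suc (degree q')" unfolding q' by (subst degree_mult_eq) auto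
    have "map_poly h q = [:- h r, 1:] * map_poly h q'"
      unfolding q' using h by (subst map_poly_hom_mult) (auto simp: map_poly_pCons h_minus)
    then have "y = h r \<or> poly (map_poly h q') y = 0" using less.prems by auto
    then show ?case using less.hyps[of q'] \<open>q' \<noteq> 0\<close> deg by auto
  qed
  obtain p where p: "p \<noteq> 0" "\<And>i. coeff p i \<in> range h" "poly p y = 0"
    using y by (auto simp: algebraic_over_def)
  \<comment> \<open>Coefficientwise application is faithful only for maps fixing \<open>0\<close>,
    on account of the coefficients beyond the degree.\<close>
  have inv0: "inv h 0 = 0" using h_eq_0 f_inv_into_f[of 0 h UNIV] h(1) by (metis rangeI)
  have "map_poly h (map_poly (inv h) p) = p"
    by (intro poly_eqI) (simp add: coeff_map_poly h(1) inv0 f_inv_into_f[OF p(2)])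
  moreover from this have "map_poly (inv h) p \<noteq> 0" using p(1) by auto
  ultimately show ?thesis using roots p(3) by metis
qed

lemma is_subfield_image:
  fixes h :: "'a::field \<Rightarrow> 'b::field"
  assumes S: "is_subfield S" and h: "h 1 = 1"
    "\<And>x y. x \<in> S \<Longrightarrow> y \<in> S \<Longrightarrow> h (x + y) = h x + h y"
    "\<And>x y. x \<in> S \<Longrightarrow> y \<in> S \<Longrightarrow> h (x * y) = h x * h y"
  shows "is_subfield (h ` S)" "h 0 = 0" "inj_on h S"
proof -
  note S' = is_subfieldD[OF S]
  show h0: "h 0 = 0" using h(2)[OF S'(1) S'(1)] by (metis add_0 add_left_cancel add.right_neutral)
  have h_minus: "h (- x) = - h x" if "x \<in> S" for x
    using h0 h(2)[of x "- x"] S' that by (simp add: eq_neg_iff_add_eq_0 add.commute)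
  have h_inv: "h (inverse x) = inverse (h x)" "h x \<noteq> 0" if "x \<in> S" "x \<noteq> 0" for x
  proof -
    have "h x * h (inverse x) = 1" using h(1) h(3)[of x "inverse x"] S' that by simp
    then show "h (inverse x) = inverse (h x)" "h x \<noteq> 0" by (auto dest: inverse_unique)
  qed
  show "inj_on h S"
  proof (rule inj_onI, rule ccontr)
    fix x y assume xy: "x \<in> S" "y \<in> S" "h x = h y" "x \<noteq> y"
    then have "h (x + - y) \<noteq> 0" using S' by (intro h_inv) auto
    moreover have "h (x + - y) = 0" using xy S' h(2)[of x "- y"] h_minus[of y] by simp
    ultimately show False by contradiction
  qed
  show "is_subfield (h ` S)"
    unfolding is_subfield_def
  proof (intro conjI ballI impI)
    show "0 \<in> h ` S" using h0 S' by force
    show "1 \<in> h ` S" using h(1) S' by force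
    fix x assume "x \<in> h ` S"
    then obtain u where u: "u \<in> S" "x = h u" by blast
    have "h (- u) \<in> h ` S" using S'(5)[OF u(1)] by blast
    then show "- x \<in> h ` S" using u h_minus by simp
    show "inverse x \<in> h ` S" if "x \<noteq> 0"
    proof -
      have "u \<noteq> 0" using that u(2) h0 by auto
      then have "inverse x = h (inverse u)" using h_inv u by simp
      then show ?thesis using S'(6)[OF u(1)] by blast
    qed
    fix y assume "y \<in> h ` S"
    then obtain w where w: "w \<in> S" "y = h w" by blast
    have "h (u + w) \<in> h ` S" "h (u * w) \<in> h ` S" using u(1) w(1) S' by blast+
    then show "x + y \<in> h ` S" "x * y \<in> h ` S" using u w h by simp_all
  qed
qed

text \<open>Both inclusions are minimality of a composite, applied to a preimage of a subfield for
  one and to an image of a subfield for the other.\<close>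

lemma image_composite:
  fixes h :: "'a::field \<Rightarrow> 'b::field"
  assumes h: "h 1 = 1" "\<And>x y. h (x + y) = h x + h y" "\<And>x y. h (x * y) = h x * h y"
  shows "h ` composite A B = composite (h ` A) (h ` B)"
proof
  have h0: "h 0 = 0" using is_subfield_image(2)[OF is_subfield_UNIV h] .
  have h_minus: "h (- x) = - h x" for x
    using h0 h(2)[of x "- x"] by (simp add: eq_neg_iff_add_eq_0 add.commute)
  have h_inv: "h (inverse x) = inverse (h x)" if "x \<noteq> 0" for x
  proof -
    have "h x * h (inverse x) = 1" using h(1) h(3)[of x "inverse x"] that by simp
    then show ?thesis by (auto dest: inverse_unique)
  qed
  have "is_subfield (h -` composite (h ` A) (h ` B))"
    unfolding is_subfield_def
    by (auto simp: h h0 h_minus h_inv intro: is_subfieldD[OF is_subfield_composite])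
  then have "composite A B \<subseteq> h -` composite (h ` A) (h ` B)"
    using composite_upper(1)[of "h ` A" "h ` B"] composite_upper(2)[of "h ` B" "h ` A"]
    by (intro composite_minimal) auto
  then show "h ` composite A B \<subseteq> composite (h ` A) (h ` B)" by blast
  show "composite (h ` A) (h ` B) \<subseteq> h ` composite A B"
    using composite_upper(1)[of A B] composite_upper(2)[of B A]
    by (intro composite_minimal is_subfield_image is_subfield_composite h image_mono)
qed

section \<open>Duals\<close>

text \<open>Through \<open>\<theta>\<close>, \<open>F\<close> has dimension \<open>n\<close> over
  \<open>K\<close>, and so has its dual \<open>D\<close>; as an \<open>F\<close>-space
  \<open>D\<close> is thus one-dimensional and generated by any nonzero functional. The choice
  \<open>\<theta> = lam\<close> gives the right dual of V(lam), the identity the left dual.\<close>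

lemma dual_cyclic:
  fixes K F :: "'a::field set" and \<theta> :: "'a \<Rightarrow> 'a"
  assumes K: "is_subfield K" and F: "is_subfield F" and \<theta>F: "\<theta> ` K \<subseteq> F"
    and \<theta>: "\<theta> 1 = 1" "\<And>x y. x \<in> K \<Longrightarrow> y \<in> K \<Longrightarrow> \<theta> (x + y) = \<theta> x + \<theta> y"
      "\<And>x y. x \<in> K \<Longrightarrow> y \<in> K \<Longrightarrow> \<theta> (x * y) = \<theta> x * \<theta> y"
    and dim: "has_dim (\<theta> ` K) (\<lambda>a v. a * v) (+) 0 F n"
    and D: "D = {\<psi>. \<psi> \<in> extensional F \<and> \<psi> \<in> F \<rightarrow> K \<and> (\<forall>x\<in>F. \<forall>y\<in>F. \<psi> (x + y) = \<psi> x + \<psi> y) \<and>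
               (\<forall>x\<in>F. \<forall>b\<in>K. \<psi> (x * \<theta> b) = \<psi> x * b)}"
  shows "\<exists>\<psi>0\<in>D. bij_betw (\<lambda>f. restrict (\<lambda>x. \<psi>0 (f * x)) F) F D"
proof -
  note K' = is_subfieldD[OF K] and F' = is_subfieldD[OF F]
  define L where "L = \<theta> ` K"
  have L: "is_subfield L" and \<theta>0: "\<theta> 0 = 0" and inj: "inj_on \<theta> K"
    using is_subfield_image[OF K \<theta>] by (auto simp: L_def)
  note L' = is_subfieldD[OF L]
  have \<theta>K: "\<theta> a \<in> L" "\<theta> a \<in> F" if "a \<in> K" for a using that \<theta>F by (auto simp: L_def)
  obtain b where bF: "\<forall>i<n. b i \<in> F"
    and span: "\<forall>v\<in>F. \<exists>c. (\<forall>i<n. c i \<in> L) \<and> v = (\<Sum>i<n. c i * b i)"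
    and indep: "\<forall>c. (\<forall>i<n. c i \<in> L) \<and> (\<Sum>i<n. c i * b i) = 0 \<longrightarrow> (\<forall>i<n. c i = 0)"
    using dim[folded L_def] unfolding has_dim_iff_sum[OF L F'(1)] by (elim exE conjE)
  \<comment> \<open>An empty basis could not represent \<open>1\<close>; this makes the index
    \<open>0\<close> below available.\<close>
  have n: "n > 0"
  proof (rule ccontr)
    assume "\<not> n > 0"
    then show False using span[rule_format, OF F'(2)] by simp
  qed
  have "\<forall>v. \<exists>c. v \<in> F \<longrightarrow> (\<forall>i<n. c i \<in> L) \<and> v = (\<Sum>i<n. c i * b i)" using span by blast
  from choice[OF this] obtain C where "\<forall>v. v \<in> F \<longrightarrow> (\<forall>i<n. C v i \<in> L) \<and> v = (\<Sum>i<n. C v i * b i)" ..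
  then have CL: "\<And>v i. v \<in> F \<Longrightarrow> i < n \<Longrightarrow> C v i \<in> L"
    and C: "\<And>v. v \<in> F \<Longrightarrow> (\<Sum>i<n. C v i * b i) = v" by simp_all
  have C_eq: "C v i = c i"
    if v: "v \<in> F" and c: "\<And>i. i < n \<Longrightarrow> c i \<in> L" "(\<Sum>i<n. c i * b i) = v" and i: "i < n" for v c i
  proof -
    have "(\<Sum>i<n. (C v i - c i) * b i) = 0"
      using C[OF v] c(2) by (simp add: left_diff_distrib sum_subtractf)
    moreover have "\<forall>i<n. C v i - c i \<in> L" using CL[OF v] c(1) by (auto intro: L')
    ultimately have "\<forall>i<n. C v i - c i = 0"
      by (intro indep[THEN spec[where x = "\<lambda>i. C v i - c i"], THEN mp] conjI)
    then show ?thesis using i by simp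
  qed
  define \<iota> where "\<iota> = inv_into K \<theta>"
  have \<iota>\<theta>: "\<iota> (\<theta> a) = a" if "a \<in> K" for a using inj that by (simp add: \<iota>_def)
  have \<iota>K: "\<iota> u \<in> K" and \<theta>\<iota>: "\<theta> (\<iota> u) = u" if "u \<in> L" for u
    using that by (auto simp: \<iota>_def L_def inv_into_into f_inv_into_f)
  \<comment> \<open>The generator is the coordinate at \<open>b 0\<close>, with
    \<open>\<iota>\<close> taking the scalar from \<open>L\<close> back to \<open>K\<close>.\<close>
  define \<psi>0 where "\<psi>0 = restrict (\<lambda>v. \<iota> (C v 0)) F"
  have "\<psi>0 \<in> D"
    unfolding D
  proof (intro CollectI conjI ballI)
    show "\<psi>0 \<in> extensional F" by (simp add: \<psi>0_def)
    show "\<psi>0 \<in> F \<rightarrow> K" using n CL by (auto simp: \<psi>0_def intro: \<iota>K)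
  next
    fix x y assume xy: "x \<in> F" "y \<in> F"
    have "C (x + y) 0 = C x 0 + C y 0"
      using xy C[of x] C[of y] n
      by (intro C_eq[where c = "\<lambda>i. C x i + C y i"]) (auto intro: F' L' CL simp: distrib_right sum.distrib)
    also have "\<dots> = \<theta> (\<iota> (C x 0) + \<iota> (C y 0))"
      using CL n xy by (simp add: \<theta> \<iota>K \<theta>\<iota>)
    finally show "\<psi>0 (x + y) = \<psi>0 x + \<psi>0 y"
      using CL n xy by (simp add: \<psi>0_def F' \<iota>\<theta> \<iota>K K')
  next
    fix x a assume x: "x \<in> F" and a: "a \<in> K"
    have "C (x * \<theta> a) 0 = C x 0 * \<theta> a"
      using x a C[of x] n \<theta>K[OF a]
      by (intro C_eq[where c = "\<lambda>i. C x i * \<theta> a"])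
         (auto intro: F' L' CL simp: sum_distrib_right mult_ac simp flip: sum_distrib_left)
    also have "\<dots> = \<theta> (\<iota> (C x 0) * a)"
      using CL n x a by (simp add: \<theta> \<iota>K \<theta>\<iota>)
    finally show "\<psi>0 (x * \<theta> a) = \<psi>0 x * a"
      using CL n x a \<theta>K by (simp add: \<psi>0_def F' \<iota>\<theta> \<iota>K K')
  qed
  have b0: "b 0 \<in> F" using bF n by blast
  \<comment> \<open>The conditional is the coordinate family of \<open>b 0\<close> read at index
    \<open>0\<close>, in the form that \<open>C_eq\<close> produces.\<close>
  have "C (b 0) 0 = (if 0 = (0::nat) then 1 else 0)"
    using b0 n by (intro C_eq[where c = "\<lambda>i. if i = 0 then 1 else 0"]) (auto intro: L' simp: if_distrib[of "\<lambda>x. x * _"] sum.delta cong: if_cong)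
  then have \<psi>0b: "\<psi>0 (b 0) = 1" using b0 \<iota>\<theta>[OF K'(2)] \<theta>(1) by (simp add: \<psi>0_def)
  have D_sum: "\<psi> (\<Sum>j<m. x j * \<theta> (c j)) = (\<Sum>j<m. \<psi> (x j) * c j)"
    if "\<psi> \<in> D" "\<And>j. j < m \<Longrightarrow> x j \<in> F" "\<And>j. j < m \<Longrightarrow> c j \<in> K" for \<psi> x c and m :: nat
    using that(2,3)
  proof (induction m)
    case 0
    have "\<psi> (0 + 0) = \<psi> 0 + \<psi> 0" using that(1) F'(1) unfolding D by blast
    then have "\<psi> 0 = 0" by (metis add_0 add_left_cancel add.right_neutral)
    then show ?case by simp
  next
    case (Suc m)
    have "(\<Sum>j<m. x j * \<theta> (c j)) \<in> F"
      using Suc.prems \<theta>K by (intro is_subfield_sum[OF F]) (auto intro: F')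
    moreover have "x m * \<theta> (c m) \<in> F" using Suc.prems \<theta>K by (auto intro: F')
    ultimately have "\<psi> (\<Sum>j<Suc m. x j * \<theta> (c j)) = \<psi> (\<Sum>j<m. x j * \<theta> (c j)) + \<psi> (x m * \<theta> (c m))"
      using that(1) unfolding D by simp
    moreover have "\<psi> (x m * \<theta> (c m)) = \<psi> (x m) * c m" using that(1) Suc.prems unfolding D by simp
    ultimately show ?case using Suc by simp
  qed
  have DK: "\<psi> x \<in> K" if "\<psi> \<in> D" "x \<in> F" for \<psi> x using that unfolding D by blast
  have D_mult: "\<psi> (x * \<theta> a) = \<psi> x * a" if "\<psi> \<in> D" "x \<in> F" "a \<in> K" for \<psi> x a
    using that unfolding D by blast
  have D_add: "\<psi> (x + y) = \<psi> x + \<psi> y" if "\<psi> \<in> D" "x \<in> F" "y \<in> F" for \<psi> x y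
    using that unfolding D by blast
  define \<Phi> where "\<Phi> f = restrict (\<lambda>x. \<psi>0 (f * x)) F" for f
  have \<Phi>D: "\<Phi> f \<in> D" if f: "f \<in> F" for f
    unfolding D using f \<theta>K DK[OF \<open>\<psi>0 \<in> D\<close>] D_mult[OF \<open>\<psi>0 \<in> D\<close>] D_add[OF \<open>\<psi>0 \<in> D\<close>]
    by (auto simp: \<Phi>_def F' distrib_left mult.assoc[symmetric])
  \<comment> \<open>A nonzero \<open>f\<close> is invertible in \<open>F\<close>, so its multiples
    include \<open>b 0\<close>, where \<open>\<psi>0\<close> takes the value
    \<open>1\<close>.\<close>
  have nondeg: "f = 0" if f: "f \<in> F" and 0: "\<And>x. x \<in> F \<Longrightarrow> \<psi>0 (f * x) = 0" for f
  proof (rule ccontr)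
    assume "f \<noteq> 0"
    then have eq: "f * (inverse f * b 0) = b 0" by simp
    have "inverse f * b 0 \<in> F" using f b0 by (intro F')
    from 0[OF this] have "\<psi>0 (b 0) = 0" unfolding eq .
    then show False using \<psi>0b by simp
  qed
  have "inj_on \<Phi> F"
  proof (rule inj_onI)
    fix f f' assume f: "f \<in> F" "f' \<in> F" "\<Phi> f = \<Phi> f'"
    have "\<psi>0 ((f - f') * x) = 0" if "x \<in> F" for x
    proof -
      have "\<psi>0 (f * x) = \<psi>0 (f' * x)" using f(3) that unfolding \<Phi>_def by (metis restrict_apply')
      moreover have "\<psi>0 ((f - f') * x + f' * x) = \<psi>0 ((f - f') * x) + \<psi>0 (f' * x)"
        using f that by (intro D_add \<open>\<psi>0 \<in> D\<close> F')
      ultimately show ?thesis by (simp add: algebra_simps)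
    qed
    with F'(7)[OF f(1,2)] have "f - f' = 0" by (rule nondeg)
    then show "f = f'" by simp
  qed
  moreover have "\<exists>f\<in>F. \<Phi> f = \<psi>" if \<psi>: "\<psi> \<in> D" for \<psi>
  proof -
    \<comment> \<open>Columns \<open>j < n\<close> are the functionals \<open>\<Phi> (b j)\<close>
      and column \<open>n\<close> is \<open>\<psi>\<close>, all evaluated on the basis:
      \<open>n\<close> equations in \<open>n + 1\<close> unknowns over \<open>K\<close>.\<close>
    define a where "a i j = (if j < n then \<psi>0 (b j * b i) else \<psi> (b i))" for i j
    have "\<exists>c. (\<forall>j\<in>{..n}. c j \<in> K) \<and> (\<exists>j\<in>{..n}. c j \<noteq> 0) \<and> (\<forall>i\<in>{..<n}. (\<Sum>j\<in>{..n}. a i j * c j) = 0)"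
      using bF by (intro underdetermined_system K) (auto simp: a_def intro!: DK[OF \<open>\<psi>0 \<in> D\<close>] DK[OF \<psi>] F')
    then obtain c where cK: "\<And>j. j \<le> n \<Longrightarrow> c j \<in> K" and cne: "\<exists>j\<le>n. c j \<noteq> 0"
      and c: "\<And>i. i < n \<Longrightarrow> (\<Sum>j\<le>n. a i j * c j) = 0" by auto
    have c: "(\<Sum>j<n. \<psi>0 (b j * b i) * c j) = - \<psi> (b i) * c n" if "i < n" for i
      using c[OF that] by (simp add: lessThan_Suc_atMost[symmetric] a_def eq_neg_iff_add_eq_0)
    define f where "f = (\<Sum>j<n. b j * \<theta> (c j))"
    have fF: "f \<in> F" unfolding f_def using bF cK \<theta>K by (intro is_subfield_sum[OF F]) (auto intro: F')
    have fb: "\<psi>0 (f * b i) = - \<psi> (b i) * c n" if "i < n" for i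
    proof -
      have "f * b i = (\<Sum>j<n. (b j * b i) * \<theta> (c j))"
        by (simp add: f_def sum_distrib_left sum_distrib_right mult_ac)
      also have "\<psi>0 \<dots> = (\<Sum>j<n. \<psi>0 (b j * b i) * c j)"
        using bF cK that by (intro D_sum \<open>\<psi>0 \<in> D\<close>) (auto intro: F')
      finally show ?thesis using c[OF that] by simp
    qed
    \<comment> \<open>The identity known on the basis spreads to all of \<open>F\<close> by
      linearity, with \<open>d\<close> the coordinates of \<open>x\<close> moved into
      \<open>K\<close>.\<close>
    have fx: "\<psi>0 (f * x) = - \<psi> x * c n" if x: "x \<in> F" for x
    proof -
      define d where "d i = \<iota> (C x i)" for i
      have dK: "d i \<in> K" if "i < n" for i using \<iota>K CL x that by (simp add: d_def)
      have xd: "x = (\<Sum>i<n. b i * \<theta> (d i))"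
        using C[OF x] CL[OF x] by (simp add: d_def \<theta>\<iota> mult.commute)
      have "f * x = (\<Sum>i<n. (f * b i) * \<theta> (d i))"
        unfolding xd by (simp add: sum_distrib_left mult_ac)
      also have "\<psi>0 \<dots> = (\<Sum>i<n. \<psi>0 (f * b i) * d i)"
        using bF fF dK by (intro D_sum \<open>\<psi>0 \<in> D\<close>) (auto intro: F')
      also have "\<dots> = - (\<Sum>i<n. \<psi> (b i) * d i) * c n"
        by (simp add: fb sum_distrib_left sum_distrib_right sum_negf mult_ac)
      also have "(\<Sum>i<n. \<psi> (b i) * d i) = \<psi> x"
        unfolding xd using bF dK by (intro D_sum[symmetric] \<psi>) auto
      finally show ?thesis .
    qed
    \<comment> \<open>If \<open>\<psi>\<close> dropped out of the relation, then
      \<open>f = 0\<close>, and independence of \<open>b\<close> would make all coefficients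
      vanish.\<close>
    have "c n \<noteq> 0"
    proof
      assume cn: "c n = 0"
      then have "\<psi>0 (f * x) = 0" if "x \<in> F" for x using fx[OF that] by simp
      with fF have "f = 0" by (rule nondeg)
      then have "(\<Sum>j<n. \<theta> (c j) * b j) = 0" by (simp add: f_def mult.commute)
      moreover have "\<forall>j<n. \<theta> (c j) \<in> L" using \<theta>K cK by simp
      ultimately have "\<forall>j<n. \<theta> (c j) = 0"
        by (intro indep[THEN spec[where x = "\<lambda>j. \<theta> (c j)"], THEN mp] conjI)
      then have "\<forall>j<n. c j = 0" using \<iota>\<theta> cK \<theta>0 K'(1) by (metis less_imp_le)
      then show False using cne cn by (metis le_neq_implies_less)
    qed
    \<comment> \<open>Rescaling by \<open>- inverse (c n)\<close> solves \<open>fx\<close> for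
      \<open>\<psi>\<close>.\<close>
    define f' where "f' = f * \<theta> (- inverse (c n))"
    have iK: "- inverse (c n) \<in> K" using cK by (intro K') simp
    then have "f' \<in> F" unfolding f'_def using fF \<theta>K F' by blast
    moreover have "\<Phi> f' = \<psi>"
    proof (rule extensionalityI[of _ F])
      show "\<Phi> f' \<in> extensional F" by (simp add: \<Phi>_def)
      show "\<psi> \<in> extensional F" using \<psi> by (simp add: D)
      fix x assume x: "x \<in> F"
      have "f' * x = (f * x) * \<theta> (- inverse (c n))" by (simp add: f'_def mult_ac)
      from arg_cong[OF this, of \<psi>0] have "\<psi>0 (f' * x) = \<psi>0 (f * x) * (- inverse (c n))"
        using D_mult[OF \<open>\<psi>0 \<in> D\<close> F'(4)[OF fF x] iK] by (rule trans)
      also have "\<dots> = \<psi> x" using fx[OF x] \<open>c n \<noteq> 0\<close> by simp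
      finally show "\<Phi> f' x = \<psi> x" using x by (simp add: \<Phi>_def)
    qed
    ultimately show ?thesis by blast
  qed
  ultimately have "bij_betw \<Phi> F D" using \<Phi>D unfolding bij_betw_def by blast
  then show ?thesis using \<open>\<psi>0 \<in> D\<close> unfolding \<Phi>_def by blast
qed

text \<open>The isomorphism is \<open>g\<close> after the inverse of \<open>f\<close>. Closure of
  \<open>V\<close> keeps sums and multiples in the domain where that inverse cancels
  \<open>f\<close>. This allows both duals and V(mu) to be compared through one model.\<close>

lemma tsv_iso_common_source:
  assumes V: "\<And>x y. x \<in> tcar V \<Longrightarrow> y \<in> tcar V \<Longrightarrow> tadd V x y \<in> tcar V"
      "\<And>a x. a \<in> K \<Longrightarrow> x \<in> tcar V \<Longrightarrow> tlmul V a x \<in> tcar V"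
      "\<And>b x. b \<in> K \<Longrightarrow> x \<in> tcar V \<Longrightarrow> trmul V x b \<in> tcar V"
    and "tsv_iso K V W" "tsv_iso K V U"
  shows "tsv_iso K W U"
proof -
  obtain f where f: "bij_betw f (tcar V) (tcar W)"
     "\<forall>x\<in>tcar V. \<forall>y\<in>tcar V. f (tadd V x y) = tadd W (f x) (f y)"
     "\<forall>a\<in>K. \<forall>x\<in>tcar V. f (tlmul V a x) = tlmul W a (f x)"
     "\<forall>b\<in>K. \<forall>x\<in>tcar V. f (trmul V x b) = trmul W (f x) b"
    using assms(4) unfolding tsv_iso_def by (elim exE conjE)
  obtain g where g: "bij_betw g (tcar V) (tcar U)"
     "\<forall>x\<in>tcar V. \<forall>y\<in>tcar V. g (tadd V x y) = tadd U (g x) (g y)"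
     "\<forall>a\<in>K. \<forall>x\<in>tcar V. g (tlmul V a x) = tlmul U a (g x)"
     "\<forall>b\<in>K. \<forall>x\<in>tcar V. g (trmul V x b) = trmul U (g x) b"
    using assms(5) unfolding tsv_iso_def by (elim exE conjE)
  let ?f' = "inv_into (tcar V) f"
  have f'f: "?f' (f x) = x" if "x \<in> tcar V" for x
    using f(1) that by (simp add: bij_betw_def)
  have W: "\<exists>x\<in>tcar V. w = f x" if "w \<in> tcar W" for w
    using f(1) that by (auto simp: bij_betw_def)
  show ?thesis
    unfolding tsv_iso_def
  proof (intro exI[of _ "g \<circ> ?f'"] conjI ballI)
    show "bij_betw (g \<circ> ?f') (tcar W) (tcar U)"
      using bij_betw_inv_into[OF f(1)] g(1) by (rule bij_betw_trans)
  next
    fix w z assume "w \<in> tcar W" "z \<in> tcar W"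
    then obtain x y where xy: "x \<in> tcar V" "w = f x" "y \<in> tcar V" "z = f y" using W by blast
    have "tadd W w z = f (tadd V x y)" using f(2) xy by simp
    then show "(g \<circ> ?f') (tadd W w z) = tadd U ((g \<circ> ?f') w) ((g \<circ> ?f') z)"
      using g(2) xy V(1) by (simp add: f'f)
  next
    fix a w assume a: "a \<in> K" and "w \<in> tcar W"
    then obtain x where x: "x \<in> tcar V" "w = f x" using W by blast
    have "tlmul W a w = f (tlmul V a x)" "trmul W w a = f (trmul V x a)" using f(3,4) x a by simp_all
    then show "(g \<circ> ?f') (tlmul W a w) = tlmul U a ((g \<circ> ?f') w)"
        "(g \<circ> ?f') (trmul W w a) = trmul U ((g \<circ> ?f') w) a"
      using g(3,4) x a V(2,3) by (simp_all add: f'f)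
  qed
qed

section \<open>The degree of the composite over K\<close>

text \<open>Two automorphisms over \<open>K\<close> agree on a subfield containing \<open>K\<close>;
  if they agree on the image of \<open>\<sigma>\<close> as well, they agree on the composite.
  Composition with \<open>\<sigma>\<close> therefore matches the restrictions bijectively with the
  orbit.\<close>

lemma has_dim_card_orbit:
  assumes perf: "perfect_subfield K" and cl: "is_alg_closure_of K" and fin: "finite (orbit K \<sigma>)"
  shows "has_dim K (\<lambda>a v. a * v) (+) 0 (composite K (\<sigma> ` K)) (card (orbit K \<sigma>))"
proof -
  let ?F = "composite K (\<sigma> ` K)"
  define T where "T = {restrict g ?F | g. g \<in> Aut_over K}"
  define \<rho> where "\<rho> \<tau> = restrict (\<tau> \<circ> \<sigma>) K" for \<tau> :: "'a \<Rightarrow> 'a"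
  have \<sigma>F: "\<sigma> x \<in> ?F" if "x \<in> K" for x
    using composite_upper(2)[of "\<sigma> ` K" K] that by blast
  have \<rho>: "\<rho> (restrict g ?F) = \<rho> g" for g
    using \<sigma>F by (auto simp: \<rho>_def fun_eq_iff)
  have "inj_on \<rho> T"
  proof (rule inj_onI)
    fix s t assume "s \<in> T" "t \<in> T" and eq: "\<rho> s = \<rho> t"
    then obtain g h where gh: "g \<in> Aut_over K" "h \<in> Aut_over K" "s = restrict g ?F" "t = restrict h ?F"
      unfolding T_def by blast
    note g = Aut_overD[OF gh(1)] and h = Aut_overD[OF gh(2)]
    have neg: "g (- x) = - g x" "h (- x) = - h x" for x
      using g(2)[of x "- x"] g(5) h(2)[of x "- x"] h(5)
      by (simp_all add: eq_neg_iff_add_eq_0 add.commute)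
    have inv: "g (inverse x) = inverse (g x)" "h (inverse x) = inverse (h x)" if "x \<noteq> 0" for x
    proof -
      have "g x * g (inverse x) = 1" "h x * h (inverse x) = 1"
        using g(3)[of x "inverse x"] h(3)[of x "inverse x"] g(6) h(6) that by simp_all
      then show "g (inverse x) = inverse (g x)" "h (inverse x) = inverse (h x)"
        by (auto dest: inverse_unique)
    qed
    have "is_subfield {x. g x = h x}"
      by (auto simp: is_subfield_def g(2,3,5,6) h(2,3,5,6) neg inv)
    moreover have "\<sigma> ` K \<subseteq> {x. g x = h x}"
    proof
      fix y assume "y \<in> \<sigma> ` K"
      then obtain x where x: "x \<in> K" "y = \<sigma> x" by blast
      have "\<rho> g x = \<rho> h x" using eq unfolding gh(3,4) \<rho> by simp
      then show "y \<in> {x. g x = h x}" using x by (simp add: \<rho>_def)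
    qed
    moreover have "K \<subseteq> {x. g x = h x}" using g(4) h(4) by auto
    ultimately have "?F \<subseteq> {x. g x = h x}" by (intro composite_minimal)
    then show "s = t" using gh by (auto simp: fun_eq_iff)
  qed
  moreover have "\<rho> ` T = orbit K \<sigma>"
  proof -
    have "\<rho> ` T = {\<rho> (restrict g ?F) | g. g \<in> Aut_over K}" unfolding T_def by blast
    also have "\<dots> = orbit K \<sigma>" unfolding \<rho> by (simp add: orbit_def \<rho>_def)
    finally show ?thesis .
  qed
  ultimately have bij: "bij_betw \<rho> T (orbit K \<sigma>)" by (simp add: bij_betw_def)
  then have "finite T" using fin bij_betw_finite by blast
  with has_dim_card_restrictions[OF perf cl is_subfield_composite composite_upper(1) T_def]
  show ?thesis using bij_betw_same_card[OF bij] by simp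
qed

section \<open>Identification of the duals and comparison of the ranks\<close>

theorem theorem3p13:
  fixes k K :: "'a::field set" and lam lambar \<mu> :: "'a \<Rightarrow> 'a" and n :: nat
  assumes closure: "is_alg_closure_of K"
    and perfect: "perfect_subfield K"
    and subk: "is_subfield k" "k \<subseteq> K"
    and lam: "lam \<in> Emb k K"
    and orb: "finite (orbit K lam)" "card (orbit K lam) = n"
    and ext: "full_emb k lambar" "\<forall>x\<in>K. lambar x = lam x"
    and mu: "\<mu> = restrict (inv lambar) K"
    and findeg: "\<exists>m. field_degree_is (composite K (lam ` K)) (lam ` K) m"
  shows "tsv_iso K (ldual K (Vsp K lam)) (rdual K (Vsp K lam)) \<and>
         tsv_iso K (rdual K (Vsp K lam)) (Vsp K \<mu>) \<and>
         (has_rank K (Vsp K lam) n \<longleftrightarrow> has_rank K (Vsp K \<mu>) n) \<and>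
         (has_rank K (Vsp K \<mu>) n \<longleftrightarrow> field_degree_is (composite K (lam ` K)) (lam ` K) n)"
proof -
  define F where "F = composite K (lam ` K)"
  have K: "is_subfield K" using perfect by (simp add: perfect_subfield_def)
  have F: "is_subfield F" by (simp add: F_def is_subfield_composite)
  note F' = is_subfieldD[OF F]
  have KF: "K \<subseteq> F" and lamF: "lam ` K \<subseteq> F"
    using composite_upper(1)[of K "lam ` K"] composite_upper(2)[of "lam ` K" K] by (auto simp: F_def)
  have lam_hom: "lam 1 = 1" "\<And>x y. x \<in> K \<Longrightarrow> y \<in> K \<Longrightarrow> lam (x + y) = lam x + lam y"
      "\<And>x y. x \<in> K \<Longrightarrow> y \<in> K \<Longrightarrow> lam (x * y) = lam x * lam y"
    using lam by (auto simp: Emb_def)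
  have L: "is_subfield (lam ` K)" and lam_inj: "inj_on lam K"
    using is_subfield_image[OF K lam_hom] by auto
  have bar: "lambar 1 = 1" "\<And>x y. lambar (x + y) = lambar x + lambar y"
      "\<And>x y. lambar (x * y) = lambar x * lambar y"
    using ext(1) by (auto simp: full_emb_def)
  have bar0: "lambar 0 = 0" and inj: "inj lambar"
    using is_subfield_image[OF is_subfield_UNIV bar] by auto
  have bar_lam: "lambar x = lam x" if "x \<in> K" for x using ext(2) that by blast
  \<comment> \<open>This finite degree makes \<open>F\<close> algebraic over the image of
    \<open>lam\<close> and supplies the basis for the right dual.\<close>
  obtain m where m: "has_dim (lam ` K) (\<lambda>a v. a * v) (+) 0 F m"
    using findeg by (auto simp: field_degree_is_def F_def)
  have cl: "alg_closed_type TYPE('a)" and alg: "\<And>x. algebraic_over K x"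
    using closure by (simp_all add: is_alg_closure_of_def)
  have alg_mono: "algebraic_over B x" if "algebraic_over A x" "A \<subseteq> B" for A B and x :: 'a
    using that unfolding algebraic_over_def by blast
  have "lam ` K \<subseteq> range lambar" using bar_lam by (metis image_subsetI rangeI)
  have "K \<subseteq> range lambar"
  proof
    fix x assume "x \<in> K"
    then have "algebraic_over (lam ` K) x"
      using KF by (intro algebraic_over_of_has_dim[OF L F m]) auto
    then show "x \<in> range lambar"
      using \<open>lam ` K \<subseteq> range lambar\<close> by (intro algebraic_over_range[OF bar0 bar cl]) (rule alg_mono)
  qed
  \<comment> \<open>The ambient field is algebraic over \<open>K\<close>, which now lies in the
    algebraically closed range, so \<open>inv lambar\<close> is a two-sided inverse.\<close>
  then have "surj lambar"
    using algebraic_over_range[OF bar0 bar cl alg_mono[OF alg]] by auto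
  define \<nu> where "\<nu> = inv lambar"
  have bar_\<nu>: "lambar (\<nu> x) = x" and \<nu>_bar: "\<nu> (lambar x) = x" for x
    using \<open>surj lambar\<close> inj by (simp_all add: \<nu>_def surj_f_inv_f)
  have \<nu>: "\<nu> (x + y) = \<nu> x + \<nu> y" "\<nu> (x * y) = \<nu> x * \<nu> y" for x y
    by (rule injD[OF inj], simp add: bar_\<nu> bar)+
  have \<mu>\<nu>: "\<mu> x = \<nu> x" if "x \<in> K" for x using that by (simp add: mu \<nu>_def)
  define F\<mu> where "F\<mu> = composite K (\<mu> ` K)"
  \<comment> \<open>The extension sends \<open>K\<close> to the image of \<open>lam\<close> and the
    image of \<open>\<mu>\<close> back to \<open>K\<close>, so the two generating fields trade
    roles.\<close>
  have "lambar ` F\<mu> = F"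
  proof -
    have "lambar ` K = lam ` K" by (intro image_cong) (auto simp: bar_lam)
    moreover have "lambar ` \<mu> ` K = K" by (force simp: image_image \<mu>\<nu> bar_\<nu>)
    ultimately have "lambar ` F\<mu> = composite (lam ` K) K"
      unfolding F\<mu>_def by (simp add: image_composite bar)
    then show ?thesis by (simp add: F_def composite_def Un_commute)
  qed
  then have F\<mu>: "F\<mu> = \<nu> ` F" by (force simp: \<nu>_bar)

  \<comment> \<open>The common model of the duals and of V(mu): \<open>F\<close> with
    \<open>lam\<close> acting on the left and plain multiplication on the right.\<close>
  define W :: "('a, 'a) tsv" where
    "W = \<lparr> tcar = F, tadd = (+), tzero = 0, tlmul = (\<lambda>a v. lam a * v), trmul = (\<lambda>v b. v * b) \<rparr>"
  have W_closed: "\<And>x y. x \<in> tcar W \<Longrightarrow> y \<in> tcar W \<Longrightarrow> tadd W x y \<in> tcar W"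
      "\<And>a x. a \<in> K \<Longrightarrow> x \<in> tcar W \<Longrightarrow> tlmul W a x \<in> tcar W"
      "\<And>b x. b \<in> K \<Longrightarrow> x \<in> tcar W \<Longrightarrow> trmul W x b \<in> tcar W"
    using KF lamF by (auto simp: W_def intro: F')
  have dimK: "has_dim K (\<lambda>a v. a * v) (+) 0 F n"
    unfolding F_def orb(2)[symmetric] by (intro has_dim_card_orbit perfect closure orb(1))

  have W_rdual: "tsv_iso K W (rdual K (Vsp K lam))"
  proof -
    let ?D = "tcar (rdual K (Vsp K lam))"
    have D: "?D = {\<psi>. \<psi> \<in> extensional F \<and> \<psi> \<in> F \<rightarrow> K \<and> (\<forall>x\<in>F. \<forall>y\<in>F. \<psi> (x + y) = \<psi> x + \<psi> y) \<and>
               (\<forall>x\<in>F. \<forall>b\<in>K. \<psi> (x * lam b) = \<psi> x * b)}"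
      by (simp add: rdual_def Vsp_def F_def)
    obtain \<psi> where \<psi>: "\<psi> \<in> ?D" and b: "bij_betw (\<lambda>f. restrict (\<lambda>x. \<psi> (f * x)) F) F ?D"
      using dual_cyclic[OF K F lamF lam_hom m D] by blast
    have \<psi>_add: "\<psi> (x + y) = \<psi> x + \<psi> y" if "x \<in> F" "y \<in> F" for x y
      using \<psi> that unfolding D by blast
    have \<psi>_lam: "\<psi> (x * lam a) = \<psi> x * a" if "x \<in> F" "a \<in> K" for x a
      using \<psi> that unfolding D by blast
    have tcar: "tcar (Vsp K lam) = F" by (simp add: Vsp_def F_def)
    show ?thesis
      unfolding tsv_iso_def
    proof (intro exI[of _ "\<lambda>f. restrict (\<lambda>x. \<psi> (f * x)) F"] conjI ballI)
      show "bij_betw (\<lambda>f. restrict (\<lambda>x. \<psi> (f * x)) F) (tcar W) ?D" using b by (simp add: W_def)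
    next
      fix f g assume "f \<in> tcar W" "g \<in> tcar W"
      then show "restrict (\<lambda>x. \<psi> (tadd W f g * x)) F =
          tadd (rdual K (Vsp K lam)) (restrict (\<lambda>x. \<psi> (f * x)) F) (restrict (\<lambda>x. \<psi> (g * x)) F)"
        by (auto simp: W_def rdual_def tcar fun_eq_iff distrib_right \<psi>_add F')
    next
      fix a f assume a: "a \<in> K" and "f \<in> tcar W"
      then have f: "f \<in> F" by (simp add: W_def)
      \<comment> \<open>Right linearity turns the scalar \<open>a\<close> outside the functional
        into multiplication by \<open>lam a\<close> inside, which is the left action of
        \<open>W\<close>.\<close>
      have "\<psi> (lam a * f * x) = a * \<psi> (f * x)" if "x \<in> F" for x
        using \<psi>_lam[of "f * x" a] f a that by (simp add: F' mult_ac)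
      then show "restrict (\<lambda>x. \<psi> (tlmul W a f * x)) F =
          tlmul (rdual K (Vsp K lam)) a (restrict (\<lambda>x. \<psi> (f * x)) F)"
        by (auto simp: W_def rdual_def tcar fun_eq_iff)
      have "a * x \<in> F" if "x \<in> F" for x using KF a that by (auto intro: F')
      then show "restrict (\<lambda>x. \<psi> (trmul W f a * x)) F =
          trmul (rdual K (Vsp K lam)) (restrict (\<lambda>x. \<psi> (f * x)) F) a"
        by (auto simp: W_def rdual_def tcar fun_eq_iff mult.assoc) (simp_all add: Vsp_def)
    qed
  qed

  have W_ldual: "tsv_iso K W (ldual K (Vsp K lam))"
  proof -
    let ?D = "tcar (ldual K (Vsp K lam))"
    have D: "?D = {\<psi>. \<psi> \<in> extensional F \<and> \<psi> \<in> F \<rightarrow> K \<and> (\<forall>x\<in>F. \<forall>y\<in>F. \<psi> (x + y) = \<psi> x + \<psi> y) \<and>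
               (\<forall>x\<in>F. \<forall>b\<in>K. \<psi> (x * id b) = \<psi> x * b)}"
      unfolding ldual_def Vsp_def F_def by (auto simp: mult.commute)
    \<comment> \<open>For the left dual the scalars are \<open>K\<close> itself, so the basis comes
      from the orbit count rather than from \<open>m\<close>.\<close>
    have "has_dim (id ` K) (\<lambda>a v. a * v) (+) 0 F n" using dimK by simp
    then obtain \<psi> where \<psi>: "\<psi> \<in> ?D" and b: "bij_betw (\<lambda>f. restrict (\<lambda>x. \<psi> (f * x)) F) F ?D"
      using dual_cyclic[OF K F _ _ _ _ _ D] KF by auto
    have \<psi>_add: "\<psi> (x + y) = \<psi> x + \<psi> y" if "x \<in> F" "y \<in> F" for x y
      using \<psi> that unfolding D by blast
    have \<psi>_K: "\<psi> (x * a) = \<psi> x * a" if "x \<in> F" "a \<in> K" for x a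
      using \<psi> that unfolding D by auto
    have tcar: "tcar (Vsp K lam) = F" by (simp add: Vsp_def F_def)
    show ?thesis
      unfolding tsv_iso_def
    proof (intro exI[of _ "\<lambda>f. restrict (\<lambda>x. \<psi> (f * x)) F"] conjI ballI)
      show "bij_betw (\<lambda>f. restrict (\<lambda>x. \<psi> (f * x)) F) (tcar W) ?D" using b by (simp add: W_def)
    next
      fix f g assume "f \<in> tcar W" "g \<in> tcar W"
      then show "restrict (\<lambda>x. \<psi> (tadd W f g * x)) F =
          tadd (ldual K (Vsp K lam)) (restrict (\<lambda>x. \<psi> (f * x)) F) (restrict (\<lambda>x. \<psi> (g * x)) F)"
        by (auto simp: W_def ldual_def tcar fun_eq_iff distrib_right \<psi>_add F')
    next
      fix a f assume a: "a \<in> K" and "f \<in> tcar W"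
      then have f: "f \<in> F" by (simp add: W_def)
      have "\<psi> (f * a * x) = a * \<psi> (f * x)" if "x \<in> F" for x
        using \<psi>_K[of "f * x" a] f a that by (simp add: F' mult_ac)
      then show "restrict (\<lambda>x. \<psi> (trmul W f a * x)) F =
          trmul (ldual K (Vsp K lam)) (restrict (\<lambda>x. \<psi> (f * x)) F) a"
        by (auto simp: W_def ldual_def tcar fun_eq_iff)
      have "x * lam a \<in> F" if "x \<in> F" for x using lamF a that by (auto intro: F')
      then show "restrict (\<lambda>x. \<psi> (tlmul W a f * x)) F =
          tlmul (ldual K (Vsp K lam)) a (restrict (\<lambda>x. \<psi> (f * x)) F)"
        by (auto simp: W_def ldual_def tcar fun_eq_iff mult_ac) (simp_all add: Vsp_def mult_ac)
    qed
  qed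

  \<comment> \<open>The inverse of \<open>lambar\<close> turns \<open>lam a\<close> into
    \<open>a\<close> and a right factor \<open>b\<close> into \<open>\<mu> b\<close>.\<close>
  have W_\<mu>: "tsv_iso K W (Vsp K \<mu>)"
    unfolding tsv_iso_def
  proof (intro exI[of _ \<nu>] conjI ballI)
    have "inj \<nu>" by (metis bar_\<nu> injI)
    then show "bij_betw \<nu> (tcar W) (tcar (Vsp K \<mu>))"
      using F\<mu> by (simp add: W_def Vsp_def F\<mu>_def bij_betw_def inj_on_subset[OF _ subset_UNIV])
  next
    fix a x assume "a \<in> K" "x \<in> tcar W"
    then show "\<nu> (tlmul W a x) = tlmul (Vsp K \<mu>) a (\<nu> x)" "\<nu> (trmul W x a) = trmul (Vsp K \<mu>) (\<nu> x) a"
      using \<nu>_bar[of a] bar_lam by (auto simp: W_def Vsp_def \<nu> \<mu>\<nu>)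
  qed (auto simp: W_def Vsp_def \<nu>)

  have lam_bij: "bij_betw lam K (lam ` K)" using lam_inj by (simp add: bij_betw_def)
  have V_right: "has_dim K (\<lambda>b v. v * lam b) (+) 0 F n \<longleftrightarrow> has_dim (lam ` K) (\<lambda>a v. a * v) (+) 0 F n"
    using has_dim_semilinear[of id lam K "lam ` K" "\<lambda>b v. v * lam b" "\<lambda>a v. a * v" F n] lam_bij
    by (simp add: mult.commute)
  have \<mu>_left: "has_dim K (\<lambda>a v. a * v) (+) 0 F\<mu> n \<longleftrightarrow> has_dim (lam ` K) (\<lambda>a v. a * v) (+) 0 F n"
    using has_dim_semilinear[of lambar lam K "lam ` K" "\<lambda>a v. a * v" "\<lambda>a v. a * v" F\<mu> n]
      lam_bij \<open>lambar ` F\<mu> = F\<close> inj by (simp add: bar bar0 bar_lam)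
  \<comment> \<open>Because \<open>lambar\<close> undoes \<open>\<mu>\<close> on \<open>K\<close>,
    the scalars stay \<open>K\<close> here, and \<open>dimK\<close> settles this side; the left side
    of V(lam) is \<open>dimK\<close> directly.\<close>
  have \<mu>_right: "has_dim K (\<lambda>b v. v * \<mu> b) (+) 0 F\<mu> n \<longleftrightarrow> has_dim K (\<lambda>a v. a * v) (+) 0 F n"
    using has_dim_semilinear[of lambar id K K "\<lambda>b v. v * \<mu> b" "\<lambda>a v. a * v" F\<mu> n]
      \<open>lambar ` F\<mu> = F\<close> inj by (simp add: bar bar0 \<mu>\<nu> bar_\<nu> mult.commute)
  have "has_rank K (Vsp K lam) n \<longleftrightarrow> has_dim (lam ` K) (\<lambda>a v. a * v) (+) 0 F n"
    using dimK V_right by (simp add: has_rank_def Vsp_def F_def)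
  moreover have "has_rank K (Vsp K \<mu>) n \<longleftrightarrow> has_dim (lam ` K) (\<lambda>a v. a * v) (+) 0 F n"
    using dimK \<mu>_left \<mu>_right by (simp add: has_rank_def Vsp_def F\<mu>_def)
  ultimately show ?thesis
    using tsv_iso_common_source[OF W_closed W_ldual W_rdual] tsv_iso_common_source[OF W_closed W_rdual W_\<mu>]
    by (simp add: field_degree_is_def F_def)
qed

end
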